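(* Let $R$ be a ring. Then 1. $T_l(Q_l(R))=Q_l(R)^*\,T_l(R)=\{s^{-1}t\mid s\in S_l(R),\ t\in T_l(R)\}$ and $T_l(R)=R\cap T_l(Q_l(R))$. 2. $\mathfrak{l}^s_{Q_l(R)}=S_l(R)^{-1}\mathfrak{l}^s_R$ and $\mathfrak{l}^s_R=R\cap\mathfrak{l}^s_{Q_l(R)}$. 3. $Q_l^s(R)\simeq Q_l^s(Q_l(R))$.
   Context: Rings are associative with $1$ and nonzero. A multiplicative subset $S$ of $R$ is a submonoid of $(R,\cdot)$ with $1\in S$, $0\notin S$. It is a left Ore set if $Sr\cap Rs\neq\emptyset$ for all $r\in R$, $s\in S$; then $\mathrm{ass}(S):=\{r\in R\mid sr=0 \text{ for some } s\in S\}$ is an ideal. A left Ore set $S$ is a left denominator set if $rs=0$ with $r\in R$, $s\in S$ implies $r\in\mathrm{ass}(S)$. $\mathrm{Den}_l(R)$ is the set of left denominator sets of $R$; for $S\in\mathrm{Den}_l(R)$, $S^{-1}R=\{s^{-1}r\mid s\in S,r\in R\}$ is the left localization. $\mathrm{max.Den}_l(R)$ is the (non-empty) set of elements of $\mathrm{Den}_l(R)$ maximal under inclusion. $\mathcal{L}^s_l(R):=\bigcap_{S\in \mathrm{max.Den}_l(R)}S$. $T_l(R)$ is the union of all $S\in\mathrm{Den}_l(R)$ with $S\subseteq\mathcal{L}^s_l(R)$; it is the largest left denominator set of $R$ contained in $\mathcal{L}^s_l(R)$. $Q_l^s(R):=T_l(R)^{-1}R$ and $\mathfrak{l}^s_R:=\mathrm{ass}(T_l(R))$.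 $S_l(R):=S_{l,0}(R)$ is the largest (under inclusion) left denominator set $S$ of $R$ with $\mathrm{ass}(S)=0$ (it exists), and $Q_l(R):=S_l(R)^{-1}R$. The ring $R$ is identified with its image in $Q_l(R)$ under the injection $r\mapsto\frac{r}{1}$. $Q_l(R)^*$ is the group of units of $Q_l(R)$, $Q_l(R)^*\,T_l(R)$ denotes the submonoid of $(Q_l(R),\cdot)$ generated by $Q_l(R)^*$ and $T_l(R)$, and $S_l(R)^{-1}\mathfrak{l}^s_R=\{s^{-1}r\mid s\in S_l(R), r\in\mathfrak{l}^s_R\}\subseteq Q_l(R)$. *)

theory Defs
  imports "HOL-Algebra.QuotRing"
begin

definition mult_subset :: "('a, 'm) ring_scheme \<Rightarrow> 'a set \<Rightarrow> bool"
  where "mult_subset R S \<longleftrightarrow> submonoid S R \<and> \<zero>\<^bsub>R\<^esub> \<notin> S"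

definition left_Ore_set :: "('a, 'm) ring_scheme \<Rightarrow> 'a set \<Rightarrow> bool"
  where "left_Ore_set R S \<longleftrightarrow>
    mult_subset R S \<and>
    (\<forall>r\<in>carrier R. \<forall>s\<in>S. (S #>\<^bsub>R\<^esub> r) \<inter> (carrier R #>\<^bsub>R\<^esub> s) \<noteq> {})"

definition ass :: "('a, 'm) ring_scheme \<Rightarrow> 'a set \<Rightarrow> 'a set"
  where "ass R S = {r \<in> carrier R. \<exists>s\<in>S. s \<otimes>\<^bsub>R\<^esub> r = \<zero>\<^bsub>R\<^esub>}"

definition Den_l :: "('a, 'm) ring_scheme \<Rightarrow> 'a set set"
  where "Den_l R = {S. left_Ore_set R S \<and>
    (\<forall>r\<in>carrier R. \<forall>s\<in>S. r \<otimes>\<^bsub>R\<^esub> s = \<zero>\<^bsub>R\<^esub> \<longrightarrow> r \<in> ass R S)}"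

definition max_Den_l :: "('a, 'm) ring_scheme \<Rightarrow> 'a set set"
  where "max_Den_l R = {S \<in> Den_l R. \<forall>S'\<in>Den_l R. S \<subseteq> S' \<longrightarrow> S' = S}"

text \<open>
  The pair \<open>(s, r)\<close> represents the left fraction \<open>s\<inverse>r\<close>. Two such fractions are identified if
  they can be brought to a common denominator \<open>a s = b t\<close> in \<open>S\<close> with equal numerators; the
  coefficients \<open>a\<close> and \<open>b\<close> themselves need not lie in \<open>S\<close>.
\<close>

definition lfrac_rel ::
    "('a, 'm) ring_scheme \<Rightarrow> 'a set \<Rightarrow> (('a \<times> 'a) \<times> ('a \<times> 'a)) set"
  where "lfrac_rel R S = {((s, r), (t, q)).
    s \<in> S \<and> r \<in> carrier R \<and> t \<in> S \<and> q \<in> carrier R \<and>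
    (\<exists>a\<in>carrier R. \<exists>b\<in>carrier R.
       a \<otimes>\<^bsub>R\<^esub> s \<in> S \<and> a \<otimes>\<^bsub>R\<^esub> s = b \<otimes>\<^bsub>R\<^esub> t \<and> a \<otimes>\<^bsub>R\<^esub> r = b \<otimes>\<^bsub>R\<^esub> q)}"

definition lfrac :: "('a, 'm) ring_scheme \<Rightarrow> 'a set \<Rightarrow> 'a \<Rightarrow> 'a \<Rightarrow> ('a \<times> 'a) set"
  where "lfrac R S s r = lfrac_rel R S `` {(s, r)}"

text \<open>
  Sums use \<open>s\<inverse>r + t\<inverse>q = (a s)\<inverse>(a r + b q)\<close> for any \<open>a s = b t\<close> in \<open>S\<close>, and products use
  \<open>(s\<inverse>r) (t\<inverse>q) = (t' s)\<inverse>(r' q)\<close> for any \<open>t'\<close> in \<open>S\<close> and \<open>r'\<close> in \<open>R\<close> with \<open>t' r = r' t\<close>.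
  For a left denominator set all admissible choices give the same class, so each union below
  is the union of a single class.
\<close>

definition lfrac_add ::
    "('a, 'm) ring_scheme \<Rightarrow> 'a set \<Rightarrow> ('a \<times> 'a) set \<Rightarrow> ('a \<times> 'a) set \<Rightarrow> ('a \<times> 'a) set"
  where "lfrac_add R S x y =
    \<Union>{lfrac R S (a \<otimes>\<^bsub>R\<^esub> s) (a \<otimes>\<^bsub>R\<^esub> r \<oplus>\<^bsub>R\<^esub> b \<otimes>\<^bsub>R\<^esub> q) | s r t q a b.
        (s, r) \<in> x \<and> (t, q) \<in> y \<and> a \<in> carrier R \<and> b \<in> carrier R \<and>
        a \<otimes>\<^bsub>R\<^esub> s \<in> S \<and> a \<otimes>\<^bsub>R\<^esub> s = b \<otimes>\<^bsub>R\<^esub> t}"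

definition lfrac_mult ::
    "('a, 'm) ring_scheme \<Rightarrow> 'a set \<Rightarrow> ('a \<times> 'a) set \<Rightarrow> ('a \<times> 'a) set \<Rightarrow> ('a \<times> 'a) set"
  where "lfrac_mult R S x y =
    \<Union>{lfrac R S (t' \<otimes>\<^bsub>R\<^esub> s) (r' \<otimes>\<^bsub>R\<^esub> q) | s r t q t' r'.
        (s, r) \<in> x \<and> (t, q) \<in> y \<and> t' \<in> S \<and> r' \<in> carrier R \<and>
        t' \<otimes>\<^bsub>R\<^esub> r = r' \<otimes>\<^bsub>R\<^esub> t}"

definition left_localization :: "('a, 'm) ring_scheme \<Rightarrow> 'a set \<Rightarrow> ('a \<times> 'a) set ring"
  where "left_localization R S =
    \<lparr>carrier = {lfrac R S s r | s r. s \<in> S \<and> r \<in> carrier R},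
     mult = lfrac_mult R S,
     one = lfrac R S \<one>\<^bsub>R\<^esub> \<one>\<^bsub>R\<^esub>,
     zero = lfrac R S \<one>\<^bsub>R\<^esub> \<zero>\<^bsub>R\<^esub>,
     add = lfrac_add R S\<rparr>"

text \<open>The order on sets is inclusion. That a largest such set exists is a theorem about left denominator sets.\<close>

definition S_l :: "('a, 'm) ring_scheme \<Rightarrow> 'a set"
  where "S_l R = (GREATEST S. S \<in> Den_l R \<and> ass R S = {\<zero>\<^bsub>R\<^esub>})"

definition Q_l :: "('a, 'm) ring_scheme \<Rightarrow> ('a \<times> 'a) set ring"
  where "Q_l R = left_localization R (S_l R)"

definition Q_l_inj :: "('a, 'm) ring_scheme \<Rightarrow> 'a \<Rightarrow> ('a \<times> 'a) set"
  where "Q_l_inj R r = lfrac R (S_l R) \<one>\<^bsub>R\<^esub> r"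

definition L_sl :: "('a, 'm) ring_scheme \<Rightarrow> 'a set"
  where "L_sl R = \<Inter>(max_Den_l R)"

definition T_l :: "('a, 'm) ring_scheme \<Rightarrow> 'a set"
  where "T_l R = \<Union>{S \<in> Den_l R. S \<subseteq> L_sl R}"

definition Q_sl :: "('a, 'm) ring_scheme \<Rightarrow> ('a \<times> 'a) set ring"
  where "Q_sl R = left_localization R (T_l R)"

definition ass_sl :: "('a, 'm) ring_scheme \<Rightarrow> 'a set"
  where "ass_sl R = ass R (T_l R)"

definition submonoid_generated :: "('a, 'm) monoid_scheme \<Rightarrow> 'a set \<Rightarrow> 'a set"
  where "submonoid_generated M A = \<Inter>{H. submonoid H M \<and> A \<subseteq> H}"

end

theory Submission
  imports Defs
begin

text \<open>
  Put \<open>S = S\<^sub>l(R)\<close> and \<open>Q = S\<inverse>R\<close>. The submonoid generated by a left denominator set \<open>T\<close> and a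
  left denominator set of regular elements is again a left denominator set; hence every maximal
  left denominator set of \<open>R\<close> contains \<open>S\<close>, and every maximal one of \<open>Q\<close> contains the units of
  \<open>Q\<close>. A left denominator set \<open>T\<close> of \<open>R\<close> that contains \<open>S\<close> remains one in \<open>Q\<close>, while a left
  denominator set \<open>U\<close> of \<open>Q\<close> that contains the units satisfies \<open>U = S\<inverse>(R \<inter> U)\<close> with \<open>R \<inter> U\<close> a left
  denominator set of \<open>R\<close>. So \<open>U \<mapsto> R \<inter> U\<close> maps the maximal left denominator sets of \<open>Q\<close> onto those of
  \<open>R\<close>, which gives \<open>L(R) = R \<inter> L(Q)\<close> for their intersections, and then \<open>T\<^sub>l(R) = R \<inter> T\<^sub>l(Q)\<close>. Clearing
  denominators shows that \<open>U\<inverse>Q\<close> is a left ring of fractions of \<open>R\<close> with respect to \<open>R \<inter> U\<close>, and such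
  a ring is unique up to isomorphism.
\<close>

section \<open>Left localization\<close>

text \<open>The coset intersection and \<open>ass\<close> are unfolded into equations between
  elements; membership in \<open>Den_l\<close> is proved and used in this form below.\<close>

lemma Den_l_iff:
  fixes R (structure)
  shows "S \<in> Den_l R \<longleftrightarrow> submonoid S R \<and> \<zero> \<notin> S \<and>
    (\<forall>r\<in>carrier R. \<forall>s\<in>S. \<exists>s'\<in>S. \<exists>r'\<in>carrier R. s' \<otimes> r = r' \<otimes> s) \<and>
    (\<forall>r\<in>carrier R. \<forall>s\<in>S. r \<otimes> s = \<zero> \<longrightarrow> (\<exists>s'\<in>S. s' \<otimes> r = \<zero>))"
  unfolding Den_l_def left_Ore_set_def mult_subset_def ass_def r_coset_def by auto blast+

context ring
begin

lemma minus_eq_zero_iff: "\<lbrakk>x \<in> carrier R; y \<in> carrier R\<rbrakk> \<Longrightarrow> x \<ominus> y = \<zero> \<longleftrightarrow> x = y"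
  using minus_equality[of x "\<ominus> y"] by (auto simp: minus_eq r_neg)

lemma minus_r_distr:
  "\<lbrakk>x \<in> carrier R; y \<in> carrier R; z \<in> carrier R\<rbrakk> \<Longrightarrow> z \<otimes> (x \<ominus> y) = z \<otimes> x \<ominus> z \<otimes> y"
  by (simp add: minus_eq r_distr r_minus)

lemma minus_l_distr:
  "\<lbrakk>x \<in> carrier R; y \<in> carrier R; z \<in> carrier R\<rbrakk> \<Longrightarrow> (x \<ominus> y) \<otimes> z = x \<otimes> z \<ominus> y \<otimes> z"
  by (simp add: minus_eq l_distr l_minus)

end

locale left_denominator = ring R for R (structure) +
  fixes S
  assumes den: "S \<in> Den_l R"
begin

lemma S_closed: "s \<in> S \<Longrightarrow> s \<in> carrier R"
  and S_mult: "\<lbrakk>s \<in> S; t \<in> S\<rbrakk> \<Longrightarrow> s \<otimes> t \<in> S"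
  and S_one: "\<one> \<in> S"
  and S_nonzero: "\<zero> \<notin> S"
  using den unfolding Den_l_iff submonoid_def by auto

lemma Ore:
  assumes "r \<in> carrier R" "s \<in> S"
  obtains s' r' where "s' \<in> S" "r' \<in> carrier R" "s' \<otimes> r = r' \<otimes> s"
  using den assms unfolding Den_l_iff by blast

lemma right_zero:
  assumes "r \<in> carrier R" "s \<in> S" "r \<otimes> s = \<zero>"
  obtains s' where "s' \<in> S" "s' \<otimes> r = \<zero>"
  using den assms unfolding Den_l_iff by blast

text \<open>Right factors from \<open>S\<close> cancel only up to a left factor: \<open>s\<close>
  annihilates \<open>x \<ominus> y\<close> from the right, so the denominator condition gives some
  \<open>w\<close> in \<open>S\<close> that annihilates it from the left.\<close>

lemma right_cancel:
  assumes "x \<in> carrier R" "y \<in> carrier R" "s \<in> S" "x \<otimes> s = y \<otimes> s"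
  obtains w where "w \<in> S" "w \<otimes> x = w \<otimes> y"
proof -
  have "(x \<ominus> y) \<otimes> s = \<zero>"
    using assms S_closed by (simp add: minus_l_distr minus_eq_zero_iff)
  then obtain w where "w \<in> S" "w \<otimes> (x \<ominus> y) = \<zero>"
    using right_zero assms by (metis minus_closed)
  then show thesis
    using that assms S_closed by (simp add: minus_r_distr minus_eq_zero_iff)
qed

section \<open>Equality of left fractions\<close>

abbreviation frac_eq (infix "\<sim>" 50)
  where "p \<sim> q \<equiv> (p, q) \<in> lfrac_rel R S"

lemma frac_eqI:
  assumes "s \<in> S" "r \<in> carrier R" "t \<in> S" "q \<in> carrier R" "a \<in> carrier R" "b \<in> carrier R"
    "a \<otimes> s \<in> S" "a \<otimes> s = b \<otimes> t" "a \<otimes> r = b \<otimes> q"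
  shows "(s, r) \<sim> (t, q)"
  using assms unfolding lfrac_rel_def by blast

lemma frac_eqE:
  assumes "(s, r) \<sim> (t, q)"
  obtains a b where "s \<in> S" "r \<in> carrier R" "t \<in> S" "q \<in> carrier R"
    "a \<in> carrier R" "b \<in> carrier R" "a \<otimes> s \<in> S" "a \<otimes> s = b \<otimes> t" "a \<otimes> r = b \<otimes> q"
  using assms unfolding lfrac_rel_def by blast

text \<open>One admissible pair \<open>a\<close>, \<open>b\<close> controls every other pair
  \<open>x\<close>, \<open>y\<close> that equalizes the denominators, even if
  \<open>x \<otimes> s\<close> is not in \<open>S\<close>. The Ore condition compares
  \<open>x \<otimes> s\<close> with \<open>a \<otimes> s\<close>, which lies in \<open>S\<close>;
  cancelling \<open>s\<close> and then \<open>t\<close> on the right turns this into a comparison of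
  coefficients. Transitivity and the independence of sums and products from representatives rest on
  this.\<close>

lemma frac_eq_transfer:
  assumes eq: "(s, r) \<sim> (t, q)" and x: "x \<in> carrier R" and y: "y \<in> carrier R"
    and xy: "x \<otimes> s = y \<otimes> t"
  obtains w where "w \<in> S" "w \<otimes> (x \<otimes> r) = w \<otimes> (y \<otimes> q)"
proof -
  obtain a b where ab: "s \<in> S" "r \<in> carrier R" "t \<in> S" "q \<in> carrier R"
    "a \<in> carrier R" "b \<in> carrier R" "a \<otimes> s \<in> S" "a \<otimes> s = b \<otimes> t" "a \<otimes> r = b \<otimes> q"
    using eq by (rule frac_eqE)
  note c = ab(1-6) x y S_closed
  obtain u v where u: "u \<in> S" "v \<in> carrier R" "u \<otimes> (x \<otimes> s) = v \<otimes> (a \<otimes> s)"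
    using Ore[of "x \<otimes> s" "a \<otimes> s"] c ab(7) by (metis m_closed)
  have "(u \<otimes> x) \<otimes> s = (v \<otimes> a) \<otimes> s"
    using u c by (simp add: m_assoc)
  then obtain w where w: "w \<in> S" "w \<otimes> (u \<otimes> x) = w \<otimes> (v \<otimes> a)"
    using right_cancel[of "u \<otimes> x" "v \<otimes> a" s] u c by (metis m_closed)
  \<comment> \<open>Both sides agree because
    \<open>w u y t = w u x s = w v a s = w v b t\<close>.\<close>
  have "(w \<otimes> (u \<otimes> y)) \<otimes> t = (w \<otimes> (v \<otimes> b)) \<otimes> t"
    using u w c ab xy by (simp add: m_assoc)
  then obtain z where z: "z \<in> S" "z \<otimes> (w \<otimes> (u \<otimes> y)) = z \<otimes> (w \<otimes> (v \<otimes> b))"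
    using right_cancel[of "w \<otimes> (u \<otimes> y)" "w \<otimes> (v \<otimes> b)" t] u w c by (metis m_closed)
  note c' = c u(1,2) w(1) z(1)
  have "(z \<otimes> w \<otimes> u) \<otimes> (x \<otimes> r) = z \<otimes> (w \<otimes> (u \<otimes> x)) \<otimes> r"
    using c' by (simp add: m_assoc)
  also have "\<dots> = z \<otimes> (w \<otimes> v) \<otimes> (a \<otimes> r)"
    unfolding w(2) using c' by (simp add: m_assoc)
  also have "\<dots> = z \<otimes> (w \<otimes> (v \<otimes> b)) \<otimes> q"
    unfolding ab(9) using c' by (simp add: m_assoc)
  also have "\<dots> = (z \<otimes> w \<otimes> u) \<otimes> (y \<otimes> q)"
    unfolding z(2)[symmetric] using c' by (simp add: m_assoc)
  finally show thesis
    using that[of "z \<otimes> w \<otimes> u"] u w z S_mult by blast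
qed

text \<open>An Ore multiple of the common denominator \<open>b \<otimes> t\<close> is also a
  multiple of \<open>u\<close>, and the second equality is transferred along it at the cost of a
  factor \<open>w\<close>. Both \<open>v\<close> and \<open>w\<close> are in \<open>S\<close>, so
  the final denominator \<open>w v (a s)\<close> is in \<open>S\<close> as well.\<close>

lemma frac_eq_trans:
  assumes "(s, r) \<sim> (t, q)" "(t, q) \<sim> (u, p)"
  shows "(s, r) \<sim> (u, p)"
proof -
  obtain a b where ab: "s \<in> S" "r \<in> carrier R" "t \<in> S" "q \<in> carrier R"
    "a \<in> carrier R" "b \<in> carrier R" "a \<otimes> s \<in> S" "a \<otimes> s = b \<otimes> t" "a \<otimes> r = b \<otimes> q"
    using assms(1) by (rule frac_eqE)
  have up: "u \<in> S" "p \<in> carrier R"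
    using assms(2) by (auto elim: frac_eqE)
  note c = ab(1-6) up S_closed
  obtain v e where v: "v \<in> S" "e \<in> carrier R" "v \<otimes> (b \<otimes> t) = e \<otimes> u"
    using Ore[of "b \<otimes> t" u] c by (metis m_closed)
  then have "(v \<otimes> b) \<otimes> t = e \<otimes> u"
    using c by (simp add: m_assoc)
  then obtain w where w: "w \<in> S" "w \<otimes> (v \<otimes> b \<otimes> q) = w \<otimes> (e \<otimes> p)"
    using frac_eq_transfer[OF assms(2), of "v \<otimes> b" e] v c by (metis m_closed)
  have "w \<otimes> v \<otimes> a \<otimes> s = w \<otimes> v \<otimes> (a \<otimes> s)" "w \<otimes> v \<otimes> a \<otimes> s = w \<otimes> e \<otimes> u"
      "w \<otimes> v \<otimes> a \<otimes> r = w \<otimes> e \<otimes> p"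
    using w v c ab by (simp_all add: m_assoc)
  moreover have "w \<otimes> v \<otimes> (a \<otimes> s) \<in> S"
    using w v ab S_mult by blast
  ultimately show ?thesis
    using frac_eqI[of s r u p "w \<otimes> v \<otimes> a" "w \<otimes> e"] w v c by simp
qed

lemma equiv_lfrac_rel: "equiv (S \<times> carrier R) (lfrac_rel R S)"
proof (rule equivI)
  show "refl_on (S \<times> carrier R) (lfrac_rel R S)"
    by (rule refl_onI) (auto intro!: frac_eqI[where a = \<one> and b = \<one>] simp: S_closed)
  show "sym (lfrac_rel R S)"
    by (rule symI) (auto simp: lfrac_rel_def split: prod.splits, metis)
  show "trans (lfrac_rel R S)"
    by (rule transI) (auto intro: frac_eq_trans)
  show "lfrac_rel R S \<subseteq> (S \<times> carrier R) \<times> (S \<times> carrier R)"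
    by (auto simp: lfrac_rel_def)
qed

lemma mem_lfrac: "(t, q) \<in> lfrac R S s r \<longleftrightarrow> (s, r) \<sim> (t, q)"
  by (simp add: lfrac_def)

lemma lfrac_eq_iff:
  assumes "s \<in> S" "r \<in> carrier R" "t \<in> S" "q \<in> carrier R"
  shows "lfrac R S s r = lfrac R S t q \<longleftrightarrow> (s, r) \<sim> (t, q)"
  unfolding lfrac_def using eq_equiv_class_iff[OF equiv_lfrac_rel] assms by simp

lemma lfrac_eqI:
  assumes "s \<in> S" "r \<in> carrier R" "t \<in> S" "q \<in> carrier R" "a \<in> carrier R" "b \<in> carrier R"
    "a \<otimes> s \<in> S" "a \<otimes> s = b \<otimes> t" "a \<otimes> r = b \<otimes> q"
  shows "lfrac R S s r = lfrac R S t q"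
  using assms lfrac_eq_iff frac_eqI by metis

lemma lfrac_expand:
  assumes "s \<in> S" "r \<in> carrier R" "a \<in> carrier R" "a \<otimes> s \<in> S"
  shows "lfrac R S (a \<otimes> s) (a \<otimes> r) = lfrac R S s r"
  by (rule lfrac_eqI[where a = \<one> and b = a]) (use assms S_closed in auto)

section \<open>Independence of sums and products from the choices\<close>

lemma common_denominator:
  assumes "s \<in> S" "t \<in> S"
  obtains a b where "a \<in> S" "b \<in> carrier R" "a \<otimes> s \<in> S" "a \<otimes> s = b \<otimes> t"
  using Ore[of s t] assms S_closed S_mult by metis

text \<open>For any other representatives and coefficients, \<open>x\<close> and \<open>y\<close>
  first bring the two resulting denominators together. \<open>frac_eq_transfer\<close> then matches
  the left summands up to \<open>w\<close> and, after multiplication by \<open>w\<close>, the right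
  summands up to \<open>z\<close>. Thus every member of the union is the same class.\<close>

lemma lfrac_add_eq:
  assumes "s \<in> S" "r \<in> carrier R" "t \<in> S" "q \<in> carrier R" "a \<in> carrier R" "b \<in> carrier R"
    "a \<otimes> s \<in> S" "a \<otimes> s = b \<otimes> t"
  shows "lfrac_add R S (lfrac R S s r) (lfrac R S t q) = lfrac R S (a \<otimes> s) (a \<otimes> r \<oplus> b \<otimes> q)"
proof -
  have *: "lfrac R S (a' \<otimes> s') (a' \<otimes> r' \<oplus> b' \<otimes> q') = lfrac R S (a \<otimes> s) (a \<otimes> r \<oplus> b \<otimes> q)"
    if eq: "(s, r) \<sim> (s', r')" "(t, q) \<sim> (t', q')"
      and c': "a' \<in> carrier R" "b' \<in> carrier R"
      and ab': "a' \<otimes> s' \<in> S" "a' \<otimes> s' = b' \<otimes> t'" for s' r' t' q' a' b'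
  proof -
    have st': "s' \<in> S" "r' \<in> carrier R" "t' \<in> S" "q' \<in> carrier R"
      using eq by (auto elim: frac_eqE)
    note c = assms(1-6) c' st' S_closed
    obtain x y where xy: "x \<in> S" "y \<in> carrier R" "x \<otimes> (a \<otimes> s) \<in> S"
        "x \<otimes> (a \<otimes> s) = y \<otimes> (a' \<otimes> s')"
      using common_denominator[OF assms(7) ab'(1)] by metis
    have "(x \<otimes> a) \<otimes> s = (y \<otimes> a') \<otimes> s'"
      using xy c by (simp add: m_assoc)
    then obtain w where w: "w \<in> S" "w \<otimes> (x \<otimes> a \<otimes> r) = w \<otimes> (y \<otimes> a' \<otimes> r')"
      using frac_eq_transfer[OF eq(1), of "x \<otimes> a" "y \<otimes> a'"] xy c by (metis m_closed)
    have "(w \<otimes> x \<otimes> b) \<otimes> t = (w \<otimes> y \<otimes> b') \<otimes> t'"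
      using w xy c ab' assms(8) by (simp add: m_assoc)
    then obtain z where z: "z \<in> S" "z \<otimes> (w \<otimes> x \<otimes> b \<otimes> q) = z \<otimes> (w \<otimes> y \<otimes> b' \<otimes> q')"
      using frac_eq_transfer[OF eq(2), of "w \<otimes> x \<otimes> b" "w \<otimes> y \<otimes> b'"] w xy c
      by (metis m_closed)
    have e1: "z \<otimes> w \<otimes> y \<otimes> (a' \<otimes> s') = z \<otimes> w \<otimes> x \<otimes> (a \<otimes> s)"
      using z(1) w(1) xy c by (simp add: m_assoc)
    have "z \<otimes> w \<otimes> (x \<otimes> (a \<otimes> s)) \<in> S"
      using z w xy S_mult by blast
    then have e2: "z \<otimes> w \<otimes> x \<otimes> (a \<otimes> s) \<in> S"
      using z(1) w(1) xy c by (simp add: m_assoc)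
    have "z \<otimes> w \<otimes> y \<otimes> (a' \<otimes> r' \<oplus> b' \<otimes> q')
        = z \<otimes> (w \<otimes> (y \<otimes> a' \<otimes> r')) \<oplus> z \<otimes> (w \<otimes> y \<otimes> b' \<otimes> q')"
      using z(1) w(1) xy c by (simp add: m_assoc r_distr)
    also have "\<dots> = z \<otimes> w \<otimes> x \<otimes> (a \<otimes> r \<oplus> b \<otimes> q)"
      unfolding w(2)[symmetric] z(2)[symmetric]
      using z(1) w(1) xy c by (simp add: m_assoc r_distr)
    finally show ?thesis
      using e1 e2 z(1) w(1) xy(1,2) c ab' assms(7)
      by (intro lfrac_eqI[where a = "z \<otimes> w \<otimes> y" and b = "z \<otimes> w \<otimes> x"]) auto
  qed
  \<comment> \<open>The family under the union must also be nonempty: the given representatives and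
    coefficients provide a member.\<close>
  have "(s, r) \<sim> (s, r)" "(t, q) \<sim> (t, q)"
    using assms lfrac_eq_iff by blast+
  then have "lfrac R S (a \<otimes> s) (a \<otimes> r \<oplus> b \<otimes> q) \<in>
     {lfrac R S (a \<otimes> s) (a \<otimes> r \<oplus> b \<otimes> q) | s r t q a b.
        (s, r) \<in> lfrac R S s r \<and> (t, q) \<in> lfrac R S t q \<and> a \<in> carrier R \<and> b \<in> carrier R \<and>
        a \<otimes> s \<in> S \<and> a \<otimes> s = b \<otimes> t}"
    using assms unfolding mem_lfrac by blast
  with assms \<open>(s, r) \<sim> (s, r)\<close> \<open>(t, q) \<sim> (t, q)\<close> show ?thesis
    unfolding lfrac_add_def mem_lfrac by (intro equalityI Union_least) (use * in blast)+
qed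

lemma lfrac_mult_eq:
  assumes "s \<in> S" "r \<in> carrier R" "t \<in> S" "q \<in> carrier R" "t' \<in> S" "r' \<in> carrier R"
    "t' \<otimes> r = r' \<otimes> t"
  shows "lfrac_mult R S (lfrac R S s r) (lfrac R S t q) = lfrac R S (t' \<otimes> s) (r' \<otimes> q)"
proof -
  have *: "lfrac R S (t1' \<otimes> s1) (r1' \<otimes> q1) = lfrac R S (t' \<otimes> s) (r' \<otimes> q)"
    if eq: "(s, r) \<sim> (s1, r1)" "(t, q) \<sim> (t1, q1)"
      and c': "t1' \<in> S" "r1' \<in> carrier R"
      and tr: "t1' \<otimes> r1 = r1' \<otimes> t1" for s1 r1 t1 q1 t1' r1'
  proof -
    have st': "s1 \<in> S" "r1 \<in> carrier R" "t1 \<in> S" "q1 \<in> carrier R"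
      using eq by (auto elim: frac_eqE)
    note c = assms(1-6) c' st' S_closed
    obtain x y where xy: "x \<in> S" "y \<in> carrier R" "x \<otimes> (t' \<otimes> s) \<in> S"
        "x \<otimes> (t' \<otimes> s) = y \<otimes> (t1' \<otimes> s1)"
      using common_denominator[of "t' \<otimes> s" "t1' \<otimes> s1"] c S_mult by metis
    have "(x \<otimes> t') \<otimes> s = (y \<otimes> t1') \<otimes> s1"
      using xy c by (simp add: m_assoc)
    then obtain w where w: "w \<in> S" "w \<otimes> (x \<otimes> t' \<otimes> r) = w \<otimes> (y \<otimes> t1' \<otimes> r1)"
      using frac_eq_transfer[OF eq(1), of "x \<otimes> t'" "y \<otimes> t1'"] xy c by (metis m_closed)
    \<comment> \<open>The two Ore equations carry the comparison from the first factors to the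
      second: \<open>w x r'\<close> and \<open>w y r1'\<close> equalize the denominators
      \<open>t\<close> and \<open>t1\<close>, so the second equality of fractions can be
      transferred.\<close>
    have "(w \<otimes> x \<otimes> r') \<otimes> t = w \<otimes> (x \<otimes> t' \<otimes> r)"
      using w(1) xy(1,2) c assms(7) by (simp add: m_assoc)
    also have "\<dots> = (w \<otimes> y \<otimes> r1') \<otimes> t1"
      unfolding w(2) using w(1) xy(1,2) c tr by (simp add: m_assoc)
    finally obtain z where z: "z \<in> S" "z \<otimes> (w \<otimes> x \<otimes> r' \<otimes> q) = z \<otimes> (w \<otimes> y \<otimes> r1' \<otimes> q1)"
      using frac_eq_transfer[OF eq(2), of "w \<otimes> x \<otimes> r'" "w \<otimes> y \<otimes> r1'"] w xy c
      by (metis m_closed)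
    have e1: "z \<otimes> w \<otimes> y \<otimes> (t1' \<otimes> s1) = z \<otimes> w \<otimes> x \<otimes> (t' \<otimes> s)"
      using z(1) w(1) xy c by (simp add: m_assoc)
    have "z \<otimes> w \<otimes> (x \<otimes> (t' \<otimes> s)) \<in> S"
      using z w xy S_mult by blast
    then have e2: "z \<otimes> w \<otimes> x \<otimes> (t' \<otimes> s) \<in> S"
      using z(1) w(1) xy c by (simp add: m_assoc)
    have "z \<otimes> w \<otimes> y \<otimes> (r1' \<otimes> q1) = z \<otimes> (w \<otimes> y \<otimes> r1' \<otimes> q1)"
      using z(1) w(1) xy c by (simp add: m_assoc)
    also have "\<dots> = z \<otimes> w \<otimes> x \<otimes> (r' \<otimes> q)"
      unfolding z(2)[symmetric] using z(1) w(1) xy c by (simp add: m_assoc)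
    finally show ?thesis
      using e1 e2 z(1) w(1) xy(1,2) c S_mult
      by (intro lfrac_eqI[where a = "z \<otimes> w \<otimes> y" and b = "z \<otimes> w \<otimes> x"]) auto
  qed
  have refl: "(s, r) \<sim> (s, r)" "(t, q) \<sim> (t, q)"
    using assms lfrac_eq_iff by blast+
  with assms have "lfrac R S (t' \<otimes> s) (r' \<otimes> q) \<in>
     {lfrac R S (t' \<otimes> s) (r' \<otimes> q) | s r t q t' r'.
        (s, r) \<in> lfrac R S s r \<and> (t, q) \<in> lfrac R S t q \<and> t' \<in> S \<and> r' \<in> carrier R \<and>
        t' \<otimes> r = r' \<otimes> t}"
    unfolding mem_lfrac by blast
  with assms refl show ?thesis
    unfolding lfrac_mult_def mem_lfrac by (intro equalityI Union_least) (use * in blast)+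
qed

section \<open>The localization as a ring\<close>

abbreviation Loc where "Loc \<equiv> left_localization R S"

lemma localization_simps:
  "carrier Loc = {lfrac R S s r | s r. s \<in> S \<and> r \<in> carrier R}"
  "x \<otimes>\<^bsub>Loc\<^esub> y = lfrac_mult R S x y" "x \<oplus>\<^bsub>Loc\<^esub> y = lfrac_add R S x y"
  "\<one>\<^bsub>Loc\<^esub> = lfrac R S \<one> \<one>" "\<zero>\<^bsub>Loc\<^esub> = lfrac R S \<one> \<zero>"
  by (simp_all add: left_localization_def)

lemma lfrac_closed: "\<lbrakk>s \<in> S; r \<in> carrier R\<rbrakk> \<Longrightarrow> lfrac R S s r \<in> carrier Loc"
  by (auto simp: localization_simps)

lemma localization_cases:
  assumes "x \<in> carrier Loc"
  obtains s r where "s \<in> S" "r \<in> carrier R" "x = lfrac R S s r"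
  using assms by (auto simp: localization_simps)

text \<open>Over a common denominator, sums of fractions are sums of numerators, which reduces the
  additive laws to those of \<open>R\<close>.\<close>

lemma localization_cases2:
  assumes "x \<in> carrier Loc" "y \<in> carrier Loc"
  obtains s r q where "s \<in> S" "r \<in> carrier R" "q \<in> carrier R"
    "x = lfrac R S s r" "y = lfrac R S s q"
proof -
  obtain s r t q where *: "s \<in> S" "r \<in> carrier R" "x = lfrac R S s r"
    "t \<in> S" "q \<in> carrier R" "y = lfrac R S t q"
    using assms localization_cases by metis
  obtain a b where "a \<in> S" "b \<in> carrier R" "a \<otimes> s \<in> S" "a \<otimes> s = b \<otimes> t"
    using common_denominator[of s t] * by metis
  with * show thesis
    using that[of "a \<otimes> s" "a \<otimes> r" "b \<otimes> q"] lfrac_expand[of s r a] lfrac_expand[of t q b] S_closed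
    by simp
qed

lemma localization_cases3:
  assumes "x \<in> carrier Loc" "y \<in> carrier Loc" "z \<in> carrier Loc"
  obtains s r q p where "s \<in> S" "r \<in> carrier R" "q \<in> carrier R" "p \<in> carrier R"
    "x = lfrac R S s r" "y = lfrac R S s q" "z = lfrac R S s p"
proof -
  obtain s r q t p where *: "s \<in> S" "r \<in> carrier R" "q \<in> carrier R"
    "x = lfrac R S s r" "y = lfrac R S s q" "t \<in> S" "p \<in> carrier R" "z = lfrac R S t p"
    using assms localization_cases localization_cases2[of x y] by metis
  obtain a b where "a \<in> S" "b \<in> carrier R" "a \<otimes> s \<in> S" "a \<otimes> s = b \<otimes> t"
    using common_denominator[of s t] * by metis
  with * show thesis
    using that[of "a \<otimes> s" "a \<otimes> r" "a \<otimes> q" "b \<otimes> p"] S_closed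
      lfrac_expand[of s r a] lfrac_expand[of s q a] lfrac_expand[of t p b] by simp
qed

lemma lfrac_add_same:
  "\<lbrakk>s \<in> S; r \<in> carrier R; q \<in> carrier R\<rbrakk> \<Longrightarrow>
    lfrac R S s r \<oplus>\<^bsub>Loc\<^esub> lfrac R S s q = lfrac R S s (r \<oplus> q)"
  using lfrac_add_eq[of s r s q \<one> \<one>] by (simp add: localization_simps S_closed)

lemma lfrac_multI:
  assumes "s \<in> S" "r \<in> carrier R" "t \<in> S" "q \<in> carrier R" "t' \<in> S" "r' \<in> carrier R"
    "t' \<otimes> r = r' \<otimes> t"
  shows "lfrac R S s r \<otimes>\<^bsub>Loc\<^esub> lfrac R S t q = lfrac R S (t' \<otimes> s) (r' \<otimes> q)"
  using lfrac_mult_eq[OF assms] by (simp add: localization_simps)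

lemma lfrac_zero: "s \<in> S \<Longrightarrow> lfrac R S s \<zero> = \<zero>\<^bsub>Loc\<^esub>"
  using lfrac_expand[of \<one> \<zero> s] by (simp add: localization_simps S_closed S_one)

lemma lfrac_one: "s \<in> S \<Longrightarrow> lfrac R S s s = \<one>\<^bsub>Loc\<^esub>"
  using lfrac_expand[of \<one> \<one> s] by (simp add: localization_simps S_closed S_one)

lemma localization_ring: "ring Loc"
proof (rule ringI)
  have zero: "\<zero>\<^bsub>Loc\<^esub> \<in> carrier Loc" and one: "\<one>\<^bsub>Loc\<^esub> \<in> carrier Loc"
    using S_one unfolding localization_simps by blast+
  show "abelian_group Loc"
  proof (rule abelian_groupI)
    fix x y assume xy: "x \<in> carrier Loc" "y \<in> carrier Loc"
    then show "x \<oplus>\<^bsub>Loc\<^esub> y \<in> carrier Loc" "x \<oplus>\<^bsub>Loc\<^esub> y = y \<oplus>\<^bsub>Loc\<^esub> x"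
      by (rule localization_cases2; simp add: lfrac_add_same lfrac_closed a_comm)+
  next
    fix x y z assume "x \<in> carrier Loc" "y \<in> carrier Loc" "z \<in> carrier Loc"
    then show "x \<oplus>\<^bsub>Loc\<^esub> y \<oplus>\<^bsub>Loc\<^esub> z = x \<oplus>\<^bsub>Loc\<^esub> (y \<oplus>\<^bsub>Loc\<^esub> z)"
      by (rule localization_cases3) (simp add: lfrac_add_same a_assoc)
  next
    fix x assume "x \<in> carrier Loc"
    then obtain s r where sr: "s \<in> S" "r \<in> carrier R" "x = lfrac R S s r"
      by (rule localization_cases)
    then show "\<zero>\<^bsub>Loc\<^esub> \<oplus>\<^bsub>Loc\<^esub> x = x"
      using lfrac_add_same[of s \<zero> r] lfrac_zero[of s] by simp
    show "\<exists>y\<in>carrier Loc. y \<oplus>\<^bsub>Loc\<^esub> x = \<zero>\<^bsub>Loc\<^esub>"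
      using sr lfrac_add_same[of s "\<ominus> r" r] lfrac_zero[of s]
      by (intro bexI[of _ "lfrac R S s (\<ominus> r)"]) (simp_all add: lfrac_closed l_neg)
  qed (rule zero)
  show "monoid Loc"
  proof
    fix x assume "x \<in> carrier Loc"
    then obtain s r where sr: "s \<in> S" "r \<in> carrier R" "x = lfrac R S s r"
      by (rule localization_cases)
    then show "\<one>\<^bsub>Loc\<^esub> \<otimes>\<^bsub>Loc\<^esub> x = x"
      using lfrac_multI[of s s s r \<one> \<one>] by (simp add: lfrac_one S_closed S_one)
    show "x \<otimes>\<^bsub>Loc\<^esub> \<one>\<^bsub>Loc\<^esub> = x"
      using sr lfrac_multI[of s r \<one> \<one> \<one> r] S_one
      by (simp add: localization_simps(4) S_closed)
  next
    fix x y assume "x \<in> carrier Loc" "y \<in> carrier Loc"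
    then obtain s r t q where *: "s \<in> S" "r \<in> carrier R" "x = lfrac R S s r"
      "t \<in> S" "q \<in> carrier R" "y = lfrac R S t q"
      using localization_cases by metis
    obtain t' r' where "t' \<in> S" "r' \<in> carrier R" "t' \<otimes> r = r' \<otimes> t"
      using Ore * by metis
    with * show "x \<otimes>\<^bsub>Loc\<^esub> y \<in> carrier Loc"
      by (simp add: lfrac_multI lfrac_closed S_mult)
  next
    fix x y z assume "x \<in> carrier Loc" "y \<in> carrier Loc" "z \<in> carrier Loc"
    then obtain s r t q u p where *: "s \<in> S" "r \<in> carrier R" "x = lfrac R S s r"
      "t \<in> S" "q \<in> carrier R" "y = lfrac R S t q" "u \<in> S" "p \<in> carrier R" "z = lfrac R S u p"
      using localization_cases by metis
    \<comment> \<open>The Ore pair for \<open>y\<close> and \<open>z\<close> is chosen first. The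
      next one is taken against \<open>u' \<otimes> t\<close>, so that it computes
      \<open>x (y z)\<close> and, through \<open>r' \<otimes> u'\<close>, also \<open>x y\<close>;
      both bracketings then get the same denominator.\<close>
    obtain u' q' where u: "u' \<in> S" "q' \<in> carrier R" "u' \<otimes> q = q' \<otimes> u"
      using Ore * by metis
    obtain t' r' where t: "t' \<in> S" "r' \<in> carrier R" "t' \<otimes> r = r' \<otimes> (u' \<otimes> t)"
      using Ore[of r "u' \<otimes> t"] * u S_mult by metis
    have "x \<otimes>\<^bsub>Loc\<^esub> (y \<otimes>\<^bsub>Loc\<^esub> z) = lfrac R S (t' \<otimes> s) (r' \<otimes> (q' \<otimes> p))"
      using * u t S_mult by (simp add: lfrac_multI)
    moreover have "t' \<otimes> r = (r' \<otimes> u') \<otimes> t"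
      using * u t S_closed by (simp add: m_assoc)
    then have "x \<otimes>\<^bsub>Loc\<^esub> y = lfrac R S (t' \<otimes> s) (r' \<otimes> u' \<otimes> q)"
      using * u t S_closed by (simp add: lfrac_multI)
    moreover have "lfrac R S (t' \<otimes> s) (r' \<otimes> u' \<otimes> q) \<otimes>\<^bsub>Loc\<^esub> z
        = lfrac R S (\<one> \<otimes> (t' \<otimes> s)) (r' \<otimes> q' \<otimes> p)"
      unfolding *(9) using * u t S_closed S_mult S_one by (intro lfrac_multI) (simp_all add: m_assoc)
    ultimately show "x \<otimes>\<^bsub>Loc\<^esub> y \<otimes>\<^bsub>Loc\<^esub> z = x \<otimes>\<^bsub>Loc\<^esub> (y \<otimes>\<^bsub>Loc\<^esub> z)"
      using * u t S_closed by (simp add: m_assoc)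
  qed (rule one)
  fix x y z assume xyz: "x \<in> carrier Loc" "y \<in> carrier Loc" "z \<in> carrier Loc"
  show "(x \<oplus>\<^bsub>Loc\<^esub> y) \<otimes>\<^bsub>Loc\<^esub> z = x \<otimes>\<^bsub>Loc\<^esub> z \<oplus>\<^bsub>Loc\<^esub> y \<otimes>\<^bsub>Loc\<^esub> z"
  proof -
    obtain s r q t p where *: "s \<in> S" "r \<in> carrier R" "q \<in> carrier R"
      "x = lfrac R S s r" "y = lfrac R S s q" "t \<in> S" "p \<in> carrier R" "z = lfrac R S t p"
      using xyz localization_cases localization_cases2[of x y] by metis
    obtain u r1 where u: "u \<in> S" "r1 \<in> carrier R" "u \<otimes> r = r1 \<otimes> t"
      using Ore[of r t] * by metis
    \<comment> \<open>Taking this Ore pair for \<open>u \<otimes> q\<close> rather than for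
      \<open>q\<close> makes the single left factor \<open>v \<otimes> u\<close> serve both
      numerators.\<close>
    obtain v q1 where v: "v \<in> S" "q1 \<in> carrier R" "v \<otimes> (u \<otimes> q) = q1 \<otimes> t"
      using Ore[of "u \<otimes> q" t] * u S_closed by (metis m_closed)
    have r: "(v \<otimes> u) \<otimes> r = (v \<otimes> r1) \<otimes> t" and q: "(v \<otimes> u) \<otimes> q = q1 \<otimes> t"
      using * u v S_closed by (simp_all add: m_assoc)
    have "(v \<otimes> u) \<otimes> (r \<oplus> q) = (v \<otimes> r1 \<oplus> q1) \<otimes> t"
      using r q * u v S_closed by (simp add: r_distr l_distr)
    then have "(x \<oplus>\<^bsub>Loc\<^esub> y) \<otimes>\<^bsub>Loc\<^esub> z = lfrac R S (v \<otimes> u \<otimes> s) ((v \<otimes> r1 \<oplus> q1) \<otimes> p)"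
      using * u v S_closed S_mult by (simp add: lfrac_add_same lfrac_multI)
    moreover have "x \<otimes>\<^bsub>Loc\<^esub> z = lfrac R S (v \<otimes> u \<otimes> s) (v \<otimes> r1 \<otimes> p)"
      using r * u(1,2) v S_closed S_mult by (simp add: lfrac_multI)
    moreover have "y \<otimes>\<^bsub>Loc\<^esub> z = lfrac R S (v \<otimes> u \<otimes> s) (q1 \<otimes> p)"
      using q * u v S_closed S_mult by (simp add: lfrac_multI)
    ultimately show ?thesis
      using * u v S_closed S_mult by (simp add: lfrac_add_same l_distr)
  qed
  show "z \<otimes>\<^bsub>Loc\<^esub> (x \<oplus>\<^bsub>Loc\<^esub> y) = z \<otimes>\<^bsub>Loc\<^esub> x \<oplus>\<^bsub>Loc\<^esub> z \<otimes>\<^bsub>Loc\<^esub> y"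
  proof -
    obtain s r q t p where *: "s \<in> S" "r \<in> carrier R" "q \<in> carrier R"
      "x = lfrac R S s r" "y = lfrac R S s q" "t \<in> S" "p \<in> carrier R" "z = lfrac R S t p"
      using xyz localization_cases localization_cases2[of x y] by metis
    obtain u p' where u: "u \<in> S" "p' \<in> carrier R" "u \<otimes> p = p' \<otimes> s"
      using Ore[of p s] * by metis
    then have "z \<otimes>\<^bsub>Loc\<^esub> (x \<oplus>\<^bsub>Loc\<^esub> y) = lfrac R S (u \<otimes> t) (p' \<otimes> (r \<oplus> q))"
      using * by (simp add: lfrac_add_same lfrac_multI)
    moreover have "z \<otimes>\<^bsub>Loc\<^esub> x = lfrac R S (u \<otimes> t) (p' \<otimes> r)"
        "z \<otimes>\<^bsub>Loc\<^esub> y = lfrac R S (u \<otimes> t) (p' \<otimes> q)"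
      using u * by (simp_all add: lfrac_multI)
    ultimately show ?thesis
      using * u S_mult by (simp add: lfrac_add_same r_distr)
  qed
qed

end

text \<open>These properties determine the localization up to isomorphism
  (\<open>localization_iso\<close>). Stated for an arbitrary map \<open>f\<close>, they allow a
  composite of maps into an iterated localization to be recognized as a localization of
  \<open>R\<close>.\<close>

locale left_fraction_ring = left_denominator R S + Q: ring Q
  for R (structure) and S and Q (structure) +
  fixes f
  assumes hom: "f \<in> ring_hom R Q"
    and units: "s \<in> S \<Longrightarrow> f s \<in> Units Q"
    and fraction: "q \<in> carrier Q \<Longrightarrow> \<exists>s\<in>S. \<exists>r\<in>carrier R. f s \<otimes>\<^bsub>Q\<^esub> q = f r"
    and kernel: "r \<in> carrier R \<Longrightarrow> f r = \<zero>\<^bsub>Q\<^esub> \<longleftrightarrow> r \<in> ass R S"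

context left_denominator
begin

lemma lfrac_one_hom: "lfrac R S \<one> \<in> ring_hom R Loc"
proof (rule ring_hom_memI)
  fix x y assume "x \<in> carrier R" "y \<in> carrier R"
  then show "lfrac R S \<one> (x \<otimes> y) = lfrac R S \<one> x \<otimes>\<^bsub>Loc\<^esub> lfrac R S \<one> y"
    using lfrac_multI[of \<one> x \<one> y \<one> x] S_one by simp
qed (simp_all add: lfrac_closed lfrac_add_same S_one, simp add: localization_simps)

lemma lfrac_split:
  assumes "s \<in> S" "r \<in> carrier R"
  shows "lfrac R S \<one> s \<otimes>\<^bsub>Loc\<^esub> lfrac R S s r = lfrac R S \<one> r"
  using lfrac_multI[of \<one> s s r \<one> \<one>] assms S_one S_closed by simp

lemma left_fraction_ring_localization: "left_fraction_ring R S Loc (lfrac R S \<one>)"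
proof (intro left_fraction_ring.intro left_denominator_axioms localization_ring
    left_fraction_ring_axioms.intro lfrac_one_hom)
  interpret L: ring Loc by (rule localization_ring)
  fix s assume s: "s \<in> S"
  have "lfrac R S s \<one> \<otimes>\<^bsub>Loc\<^esub> lfrac R S \<one> s = \<one>\<^bsub>Loc\<^esub>"
    using lfrac_multI[of s \<one> \<one> s \<one> \<one>] s S_one S_closed by (simp add: lfrac_one)
  moreover have "lfrac R S \<one> s \<otimes>\<^bsub>Loc\<^esub> lfrac R S s \<one> = \<one>\<^bsub>Loc\<^esub>"
    using lfrac_split[of s \<one>] s by (simp add: localization_simps)
  ultimately show "lfrac R S \<one> s \<in> Units Loc"
    unfolding Units_def using lfrac_closed S_one S_closed s by blast
next
  fix q assume "q \<in> carrier Loc"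
  then show "\<exists>s\<in>S. \<exists>r\<in>carrier R. lfrac R S \<one> s \<otimes>\<^bsub>Loc\<^esub> q = lfrac R S \<one> r"
    by (rule localization_cases) (use lfrac_split in blast)
next
  fix r assume r: "r \<in> carrier R"
  show "lfrac R S \<one> r = \<zero>\<^bsub>Loc\<^esub> \<longleftrightarrow> r \<in> ass R S"
  proof
    assume "lfrac R S \<one> r = \<zero>\<^bsub>Loc\<^esub>"
    then have "(\<one>, r) \<sim> (\<one>, \<zero>)"
      using lfrac_eq_iff[of \<one> r \<one> \<zero>] r S_one by (simp add: localization_simps)
    then obtain w where "w \<in> S" "w \<otimes> (\<one> \<otimes> r) = w \<otimes> (\<one> \<otimes> \<zero>)"
      using frac_eq_transfer[of \<one> r \<one> \<zero> \<one> \<one>] by auto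
    then show "r \<in> ass R S"
      using r S_closed by (auto simp: ass_def)
  next
    assume "r \<in> ass R S"
    then obtain s where "s \<in> S" "s \<otimes> r = \<zero>"
      by (auto simp: ass_def)
    then show "lfrac R S \<one> r = \<zero>\<^bsub>Loc\<^esub>"
      using lfrac_expand[of \<one> r s] r S_closed S_one by (simp add: lfrac_zero)
  qed
qed

end

section \<open>Uniqueness of the ring of left fractions\<close>

context left_fraction_ring
begin

lemma f_closed: "r \<in> carrier R \<Longrightarrow> f r \<in> carrier Q"
  and f_mult: "\<lbrakk>r \<in> carrier R; q \<in> carrier R\<rbrakk> \<Longrightarrow> f (r \<otimes> q) = f r \<otimes>\<^bsub>Q\<^esub> f q"
  and f_add: "\<lbrakk>r \<in> carrier R; q \<in> carrier R\<rbrakk> \<Longrightarrow> f (r \<oplus> q) = f r \<oplus>\<^bsub>Q\<^esub> f q"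
  and f_one: "f \<one> = \<one>\<^bsub>Q\<^esub>"
  using hom by (simp_all add: ring_hom_closed ring_hom_mult ring_hom_add ring_hom_one)

lemma f_zero: "f \<zero> = \<zero>\<^bsub>Q\<^esub>"
  using ring_hom_zero hom ring_axioms Q.ring_axioms by blast

lemma f_minus: "\<lbrakk>r \<in> carrier R; q \<in> carrier R\<rbrakk> \<Longrightarrow> f (r \<ominus> q) = f r \<ominus>\<^bsub>Q\<^esub> f q"
  using Q.minus_equality[of "f (\<ominus> q)" "f q"] f_add[of "\<ominus> q" q]
  by (simp add: minus_eq Q.minus_eq f_add f_closed f_zero l_neg)

lemma f_eq_iff:
  assumes "r \<in> carrier R" "q \<in> carrier R"
  shows "f r = f q \<longleftrightarrow> (\<exists>w\<in>S. w \<otimes> r = w \<otimes> q)"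
proof -
  have "f r = f q \<longleftrightarrow> f (r \<ominus> q) = \<zero>\<^bsub>Q\<^esub>"
    using assms by (simp add: f_minus Q.minus_eq_zero_iff f_closed)
  also have "\<dots> \<longleftrightarrow> (\<exists>w\<in>S. w \<otimes> (r \<ominus> q) = \<zero>)"
    using assms by (simp add: kernel ass_def)
  also have "\<dots> \<longleftrightarrow> (\<exists>w\<in>S. w \<otimes> r = w \<otimes> q)"
    using assms S_closed by (intro bex_cong) (simp_all add: minus_r_distr minus_eq_zero_iff)
  finally show ?thesis .
qed

lemma one_nonzero: "\<one>\<^bsub>Q\<^esub> \<noteq> \<zero>\<^bsub>Q\<^esub>"
  using kernel[of \<one>] S_closed S_nonzero by (auto simp: ass_def f_one)

lemma units_closed: "s \<in> S \<Longrightarrow> f s \<in> carrier Q"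
  using units by blast

lemma S_left_cancel:
  assumes "s \<in> S" "x \<in> carrier Q" "y \<in> carrier Q" "f s \<otimes>\<^bsub>Q\<^esub> x = f s \<otimes>\<^bsub>Q\<^esub> y"
  shows "x = y"
  using Q.Units_l_cancel[OF units] assms by blast

definition frac where "frac s r = inv\<^bsub>Q\<^esub> f s \<otimes>\<^bsub>Q\<^esub> f r"

lemma frac_closed: "\<lbrakk>s \<in> S; r \<in> carrier R\<rbrakk> \<Longrightarrow> frac s r \<in> carrier Q"
  unfolding frac_def using units f_closed by blast

lemma frac_split: "\<lbrakk>s \<in> S; r \<in> carrier R\<rbrakk> \<Longrightarrow> f s \<otimes>\<^bsub>Q\<^esub> frac s r = f r"
  unfolding frac_def using units units_closed f_closed
  by (simp add: Q.m_assoc[symmetric])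

text \<open>Since \<open>f s\<close> is a unit, \<open>frac s r\<close> is the only solution of this
  equation. Identities between fractions can therefore be checked after multiplication by the
  denominator, without computing with inverses.\<close>

lemma eq_fracI:
  assumes "s \<in> S" "r \<in> carrier R" "x \<in> carrier Q" "f s \<otimes>\<^bsub>Q\<^esub> x = f r"
  shows "x = frac s r"
  using S_left_cancel[of s x "frac s r"] assms frac_closed frac_split by simp

lemma frac_expand:
  assumes "s \<in> S" "r \<in> carrier R" "a \<in> carrier R" "a \<otimes> s \<in> S"
  shows "frac (a \<otimes> s) (a \<otimes> r) = frac s r"
proof -
  have "f (a \<otimes> s) \<otimes>\<^bsub>Q\<^esub> frac s r = f (a \<otimes> r)"
    using assms S_closed f_closed frac_closed by (simp add: f_mult Q.m_assoc frac_split)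
  then show ?thesis
    using eq_fracI[of "a \<otimes> s" "a \<otimes> r" "frac s r"] assms frac_closed by simp
qed

lemma frac_cases:
  assumes "x \<in> carrier Q"
  obtains s r where "s \<in> S" "r \<in> carrier R" "x = frac s r"
  using fraction[OF assms] assms eq_fracI by blast

lemma frac_cases2:
  assumes "x \<in> carrier Q" "y \<in> carrier Q"
  obtains s r q where "s \<in> S" "r \<in> carrier R" "q \<in> carrier R" "x = frac s r" "y = frac s q"
proof -
  obtain s r t q where *: "s \<in> S" "r \<in> carrier R" "x = frac s r"
    "t \<in> S" "q \<in> carrier R" "y = frac t q"
    using assms frac_cases by metis
  obtain a b where "a \<in> S" "b \<in> carrier R" "a \<otimes> s \<in> S" "a \<otimes> s = b \<otimes> t"
    using common_denominator[of s t] * by metis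
  with * show thesis
    using that[of "a \<otimes> s" "a \<otimes> r" "b \<otimes> q"] frac_expand[of s r a] frac_expand[of t q b] S_closed
    by simp
qed

text \<open>Over a common denominator, equal values in \<open>Q\<close> mean that the images of the
  numerators under \<open>f\<close> agree. By the kernel condition the numerators then agree up to a
  left factor \<open>w\<close> in \<open>S\<close>, and expanding both fractions by \<open>w\<close>
  absorbs it.\<close>

lemma frac_eq_iff:
  assumes "s \<in> S" "r \<in> carrier R" "t \<in> S" "q \<in> carrier R"
  shows "frac s r = frac t q \<longleftrightarrow> lfrac R S s r = lfrac R S t q"
proof
  assume "lfrac R S s r = lfrac R S t q"
  then obtain a b where "a \<in> carrier R" "b \<in> carrier R" "a \<otimes> s \<in> S" "a \<otimes> s = b \<otimes> t"
      "a \<otimes> r = b \<otimes> q"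
    using lfrac_eq_iff assms frac_eqE by metis
  then show "frac s r = frac t q"
    using frac_expand[of s r a] frac_expand[of t q b] assms by simp
next
  assume eq: "frac s r = frac t q"
  obtain a b where ab: "a \<in> S" "b \<in> carrier R" "a \<otimes> s \<in> S" "a \<otimes> s = b \<otimes> t"
    using common_denominator[of s t] assms by metis
  then have "frac (a \<otimes> s) (a \<otimes> r) = frac (a \<otimes> s) (b \<otimes> q)"
    using frac_expand[of s r a] frac_expand[of t q b] assms S_closed eq by simp
  then have "f (a \<otimes> r) = f (b \<otimes> q)"
    using frac_split[of "a \<otimes> s"] ab assms S_closed by (metis m_closed)
  then obtain w where w: "w \<in> S" "w \<otimes> (a \<otimes> r) = w \<otimes> (b \<otimes> q)"
    using f_eq_iff ab assms S_closed by auto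
  have "lfrac R S s r = lfrac R S (a \<otimes> s) (a \<otimes> r)" "lfrac R S t q = lfrac R S (a \<otimes> s) (b \<otimes> q)"
    using ab assms S_closed lfrac_expand[of s r a] lfrac_expand[of t q b] by simp_all
  moreover have "lfrac R S (a \<otimes> s) (a \<otimes> r) = lfrac R S (a \<otimes> s) (b \<otimes> q)"
    using lfrac_expand[of "a \<otimes> s" "a \<otimes> r" w] lfrac_expand[of "a \<otimes> s" "b \<otimes> q" w]
      ab assms S_closed S_mult w by simp
  ultimately show "lfrac R S s r = lfrac R S t q"
    by simp
qed

lemma frac_add: "\<lbrakk>s \<in> S; r \<in> carrier R; q \<in> carrier R\<rbrakk> \<Longrightarrow>
    frac s r \<oplus>\<^bsub>Q\<^esub> frac s q = frac s (r \<oplus> q)"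
  unfolding frac_def using units f_closed by (simp add: f_add Q.r_distr)

lemma frac_mult:
  assumes "s \<in> S" "r \<in> carrier R" "t \<in> S" "q \<in> carrier R" "t' \<in> S" "r' \<in> carrier R"
    "t' \<otimes> r = r' \<otimes> t"
  shows "frac s r \<otimes>\<^bsub>Q\<^esub> frac t q = frac (t' \<otimes> s) (r' \<otimes> q)"
proof (rule eq_fracI)
  note c = assms(1-6) S_closed f_closed frac_closed
  have "f (t' \<otimes> s) \<otimes>\<^bsub>Q\<^esub> (frac s r \<otimes>\<^bsub>Q\<^esub> frac t q) = f t' \<otimes>\<^bsub>Q\<^esub> (f s \<otimes>\<^bsub>Q\<^esub> frac s r) \<otimes>\<^bsub>Q\<^esub> frac t q"
    using c by (simp add: f_mult Q.m_assoc)
  also have "\<dots> = f (t' \<otimes> r) \<otimes>\<^bsub>Q\<^esub> frac t q"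
    using c by (simp add: f_mult frac_split)
  also have "\<dots> = f r' \<otimes>\<^bsub>Q\<^esub> (f t \<otimes>\<^bsub>Q\<^esub> frac t q)"
    unfolding assms(7) using c by (simp add: f_mult Q.m_assoc)
  also have "\<dots> = f (r' \<otimes> q)"
    using c by (simp add: f_mult frac_split)
  finally show "f (t' \<otimes> s) \<otimes>\<^bsub>Q\<^esub> (frac s r \<otimes>\<^bsub>Q\<^esub> frac t q) = f (r' \<otimes> q)" .
qed (use assms S_mult frac_closed in auto)

theorem localization_iso: "left_localization R S \<simeq> Q"
proof -
  \<comment> \<open>The value of \<open>h\<close> on a class is the fraction in \<open>Q\<close>
    given by any representative. The two directions of \<open>frac_eq_iff\<close> make
    \<open>h\<close> well defined and injective.\<close>
  define h where "h X = (THE x. \<forall>s\<in>S. \<forall>r\<in>carrier R. X = lfrac R S s r \<longrightarrow> x = frac s r)" for X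
  have h: "h (lfrac R S s r) = frac s r" if "s \<in> S" "r \<in> carrier R" for s r
    unfolding h_def using that frac_eq_iff by (intro the_equality) metis+
  have "h \<in> ring_hom Loc Q"
  proof (rule ring_hom_memI)
    fix x assume "x \<in> carrier Loc"
    then show "h x \<in> carrier Q"
      by (rule localization_cases) (simp add: h frac_closed)
  next
    fix x y assume xy: "x \<in> carrier Loc" "y \<in> carrier Loc"
    then show "h (x \<oplus>\<^bsub>Loc\<^esub> y) = h x \<oplus>\<^bsub>Q\<^esub> h y"
      by (rule localization_cases2) (simp add: h lfrac_add_same frac_add)
    obtain s r t q where *: "s \<in> S" "r \<in> carrier R" "x = lfrac R S s r"
      "t \<in> S" "q \<in> carrier R" "y = lfrac R S t q"
      using xy localization_cases by metis
    obtain t' r' where "t' \<in> S" "r' \<in> carrier R" "t' \<otimes> r = r' \<otimes> t"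
      using Ore * by metis
    with * show "h (x \<otimes>\<^bsub>Loc\<^esub> y) = h x \<otimes>\<^bsub>Q\<^esub> h y"
      by (simp add: lfrac_multI h frac_mult S_mult)
  next
    show "h \<one>\<^bsub>Loc\<^esub> = \<one>\<^bsub>Q\<^esub>"
      unfolding localization_simps using frac_split[of \<one> \<one>] frac_closed[of \<one> \<one>] S_one
      by (simp add: h f_one)
  qed
  moreover have "bij_betw h (carrier Loc) (carrier Q)"
    unfolding bij_betw_def
  proof
    show "inj_on h (carrier Loc)"
      by (rule inj_onI) (metis localization_cases h frac_eq_iff)
    show "h ` carrier Loc = carrier Q"
    proof
      show "h ` carrier Loc \<subseteq> carrier Q"
        using h frac_closed localization_cases by (metis image_subsetI)
      show "carrier Q \<subseteq> h ` carrier Loc"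
        using h lfrac_closed frac_cases by (metis imageI subsetI)
    qed
  qed
  ultimately show ?thesis
    unfolding is_ring_iso_def ring_iso_def by blast
qed

end

section \<open>Maximal left denominator sets\<close>

context monoid
begin

lemma submonoid_carrier: "submonoid (carrier G) G"
  by unfold_locales auto

lemma submonoid_generated_submonoid:
  assumes "A \<subseteq> carrier G"
  shows "submonoid (submonoid_generated G A) G"
proof
  show "submonoid_generated G A \<subseteq> carrier G"
    unfolding submonoid_generated_def using submonoid_carrier assms by blast
qed (auto simp: submonoid_generated_def submonoid.m_closed submonoid.one_closed)

lemma submonoid_generated_incl: "A \<subseteq> submonoid_generated G A"
  by (auto simp: submonoid_generated_def)

lemma submonoid_generated_least: "\<lbrakk>submonoid H G; A \<subseteq> H\<rbrakk> \<Longrightarrow> submonoid_generated G A \<subseteq> H"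
  by (auto simp: submonoid_generated_def)

end

section \<open>Generation of left denominator sets\<close>

context ring
begin

lemma left_denominatorI: "S \<in> Den_l R \<Longrightarrow> left_denominator R S"
  by (simp add: left_denominator.intro left_denominator_axioms.intro ring_axioms)

lemma Den_l_submonoid: "S \<in> Den_l R \<Longrightarrow> submonoid S R"
  by (simp add: Den_l_iff)

lemma Den_l_carrier: "S \<in> Den_l R \<Longrightarrow> S \<subseteq> carrier R"
  using Den_l_submonoid submonoid.subset by blast

text \<open>The Ore condition and the annihilator condition both pass to products: the elements
  satisfying either one form a submonoid that contains each member of \<open>F\<close>. Witnesses
  are taken from all of \<open>?M\<close>, so that those for factors from different members of
  \<open>F\<close> can be multiplied. The exclusion of zero is not automatic and remains a
  hypothesis.\<close>

lemma generated_Den_l: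
  assumes F: "F \<subseteq> Den_l R" and nz: "\<zero> \<notin> submonoid_generated R (\<Union>F)"
  shows "submonoid_generated R (\<Union>F) \<in> Den_l R"
proof -
  let ?M = "submonoid_generated R (\<Union>F)"
  have "\<Union>F \<subseteq> carrier R"
    using F Den_l_carrier by blast
  then interpret M: submonoid ?M R
    by (rule submonoid_generated_submonoid)
  have incl: "S \<subseteq> ?M" if "S \<in> F" for S
    using submonoid_generated_incl[of "\<Union>F"] that by blast
  note c = subsetD[OF M.subset]
  have "?M \<subseteq> {s \<in> carrier R. \<forall>r\<in>carrier R. \<exists>s'\<in>?M. \<exists>r'\<in>carrier R. s' \<otimes> r = r' \<otimes> s}" (is "_ \<subseteq> ?H")
  proof (rule submonoid_generated_least)
    show "submonoid ?H R"
    proof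
      fix s t assume s: "s \<in> ?H" and t: "t \<in> ?H"
      then have st: "s \<in> carrier R" "t \<in> carrier R" by auto
      have "\<exists>s'\<in>?M. \<exists>r'\<in>carrier R. s' \<otimes> r = r' \<otimes> (s \<otimes> t)" if r: "r \<in> carrier R" for r
      proof -
        obtain t' r1 where t': "t' \<in> ?M" "r1 \<in> carrier R" "t' \<otimes> r = r1 \<otimes> t"
          using t r by blast
        obtain s' r2 where s': "s' \<in> ?M" "r2 \<in> carrier R" "s' \<otimes> r1 = r2 \<otimes> s"
          using s t' by blast
        have "(s' \<otimes> t') \<otimes> r = s' \<otimes> r1 \<otimes> t"
          using r t' s'(1,2) st c by (simp add: m_assoc)
        also have "\<dots> = r2 \<otimes> (s \<otimes> t)"
          unfolding s'(3) using s'(1,2) st by (simp add: m_assoc)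
        finally show ?thesis
          using s' t' by blast
      qed
      then show "s \<otimes> t \<in> ?H"
        using st by simp
    next
      have "\<exists>s'\<in>?M. \<exists>r'\<in>carrier R. s' \<otimes> r = r' \<otimes> \<one>" if "r \<in> carrier R" for r
        using that M.one_closed by (intro bexI[of _ \<one>] bexI[of _ r]) simp_all
      then show "\<one> \<in> ?H"
        by simp
    qed auto
    show "\<Union>F \<subseteq> ?H"
    proof
      fix s assume "s \<in> \<Union>F"
      then obtain S where S: "S \<in> F" "s \<in> S" by blast
      then interpret S: left_denominator R S
        using F left_denominatorI by blast
      have "\<exists>s'\<in>?M. \<exists>r'\<in>carrier R. s' \<otimes> r = r' \<otimes> s" if "r \<in> carrier R" for r
        using S.Ore[OF that S(2)] incl[OF S(1)] by (metis subsetD)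
      then show "s \<in> ?H"
        using S(2) S.S_closed by simp
    qed
  qed
  moreover have "?M \<subseteq> {s \<in> carrier R. \<forall>r\<in>carrier R. r \<otimes> s = \<zero> \<longrightarrow> (\<exists>w\<in>?M. w \<otimes> r = \<zero>)}" (is "_ \<subseteq> ?K")
  proof (rule submonoid_generated_least)
    have K: "\<exists>w\<in>?M. w \<otimes> r = \<zero>" if "s \<in> ?K" "r \<in> carrier R" "r \<otimes> s = \<zero>" for s r
      using that by blast
    show "submonoid ?K R"
    proof
      fix s t assume s: "s \<in> ?K" and t: "t \<in> ?K"
      then have st: "s \<in> carrier R" "t \<in> carrier R" by auto
      have "\<exists>w\<in>?M. w \<otimes> r = \<zero>" if r: "r \<in> carrier R" "r \<otimes> (s \<otimes> t) = \<zero>" for r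
      proof -
        have "(r \<otimes> s) \<otimes> t = \<zero>"
          using r st by (simp add: m_assoc)
        then obtain w where w: "w \<in> ?M" "w \<otimes> (r \<otimes> s) = \<zero>"
          using K[OF t, of "r \<otimes> s"] r st by auto
        then have "(w \<otimes> r) \<otimes> s = \<zero>"
          using r st c by (simp add: m_assoc)
        then obtain v where "v \<in> ?M" "v \<otimes> (w \<otimes> r) = \<zero>"
          using K[OF s, of "w \<otimes> r"] w(1) r c by auto
        then show ?thesis
          using w r c by (intro bexI[of _ "v \<otimes> w"]) (simp_all add: m_assoc)
      qed
      then show "s \<otimes> t \<in> ?K"
        using st by simp
    next
      have "\<exists>w\<in>?M. w \<otimes> r = \<zero>" if "r \<in> carrier R" "r \<otimes> \<one> = \<zero>" for r
        using that M.one_closed by (intro bexI[of _ \<one>]) simp_all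
      then show "\<one> \<in> ?K"
        by simp
    qed auto
    show "\<Union>F \<subseteq> ?K"
    proof
      fix s assume "s \<in> \<Union>F"
      then obtain S where S: "S \<in> F" "s \<in> S" by blast
      then interpret S: left_denominator R S
        using F left_denominatorI by blast
      have "\<exists>w\<in>?M. w \<otimes> r = \<zero>" if "r \<in> carrier R" "r \<otimes> s = \<zero>" for r
        using S.right_zero[OF that(1) S(2) that(2)] incl[OF S(1)] by (metis subsetD)
      then show "s \<in> ?K"
        using S(2) S.S_closed by simp
    qed
  qed
  ultimately show ?thesis
    unfolding Den_l_iff by (intro conjI M.submonoid_axioms nz) blast+
qed

lemma ass_zero_iff:
  assumes "S \<in> Den_l R"
  shows "ass R S = {\<zero>} \<longleftrightarrow> (\<forall>s\<in>S. \<forall>r\<in>carrier R. s \<otimes> r = \<zero> \<longrightarrow> r = \<zero>)"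
proof -
  interpret left_denominator R S
    by (rule left_denominatorI) fact
  have "\<zero> \<in> ass R S"
    using S_one r_null[OF one_closed] unfolding ass_def by blast
  then show ?thesis
    unfolding ass_def by blast
qed

text \<open>
  A product with factors in \<open>S \<union> T\<close> that vanishes can be shortened from the right: a factor in
  \<open>S\<close> cancels, and a factor in \<open>T\<close> moves to the left end as another element of \<open>T\<close>.
\<close>

lemma generated_Un_Den_l:
  assumes S: "S \<in> Den_l R" "ass R S = {\<zero>}" and T: "T \<in> Den_l R"
  shows "submonoid_generated R (S \<union> T) \<in> Den_l R"
proof -
  interpret T: left_denominator R T
    by (rule left_denominatorI) fact
  let ?K = "{w \<in> carrier R. \<forall>r\<in>carrier R. r \<otimes> w = \<zero> \<longrightarrow> (\<exists>t\<in>T. t \<otimes> r = \<zero>)}"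
  have "submonoid_generated R (S \<union> T) \<subseteq> ?K"
  proof (rule submonoid_generated_least)
    have K: "\<exists>w\<in>T. w \<otimes> r = \<zero>" if "s \<in> ?K" "r \<in> carrier R" "r \<otimes> s = \<zero>" for s r
      using that by blast
    show "submonoid ?K R"
    proof
      fix s t assume s: "s \<in> ?K" and t: "t \<in> ?K"
      then have st: "s \<in> carrier R" "t \<in> carrier R" by auto
      have "\<exists>w\<in>T. w \<otimes> r = \<zero>" if r: "r \<in> carrier R" "r \<otimes> (s \<otimes> t) = \<zero>" for r
      proof -
        have "(r \<otimes> s) \<otimes> t = \<zero>"
          using r st by (simp add: m_assoc)
        then obtain w where w: "w \<in> T" "w \<otimes> (r \<otimes> s) = \<zero>"
          using K[OF t, of "r \<otimes> s"] r st by auto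
        then have "(w \<otimes> r) \<otimes> s = \<zero>"
          using r st T.S_closed by (simp add: m_assoc)
        then obtain v where "v \<in> T" "v \<otimes> (w \<otimes> r) = \<zero>"
          using K[OF s, of "w \<otimes> r"] w(1) r T.S_closed by auto
        then show ?thesis
          using w r T.S_closed T.S_mult by (intro bexI[of _ "v \<otimes> w"]) (simp_all add: m_assoc)
      qed
      then show "s \<otimes> t \<in> ?K"
        using st by simp
    next
      have "\<exists>w\<in>T. w \<otimes> r = \<zero>" if "r \<in> carrier R" "r \<otimes> \<one> = \<zero>" for r
        using that T.S_one by (intro bexI[of _ \<one>]) simp_all
      then show "\<one> \<in> ?K"
        by simp
    qed auto
    show "S \<union> T \<subseteq> ?K"
    proof
      fix s assume "s \<in> S \<union> T"
      then show "s \<in> ?K"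
      proof
        assume s: "s \<in> S"
        interpret S: left_denominator R S
          by (rule left_denominatorI) fact
        have "\<exists>t\<in>T. t \<otimes> r = \<zero>" if r: "r \<in> carrier R" "r \<otimes> s = \<zero>" for r
        proof -
          have "r \<in> ass R S"
            using S.right_zero[OF r(1) s r(2)] r(1) by (auto simp: ass_def)
          then show ?thesis
            using S(2) T.S_one by (intro bexI[of _ \<one>]) simp_all
        qed
        then show ?thesis
          using s S.S_closed by simp
      next
        assume s: "s \<in> T"
        have "\<exists>t\<in>T. t \<otimes> r = \<zero>" if "r \<in> carrier R" "r \<otimes> s = \<zero>" for r
          using T.right_zero[OF that(1) s that(2)] by metis
        then show ?thesis
          using s T.S_closed by simp
      qed
    qed
  qed
  \<comment> \<open>If zero were generated, \<open>?K\<close> with \<open>r = \<one>\<close> would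
    give an element of \<open>T\<close> equal to zero. This works because \<open>?K\<close> asks for
    an annihilator in \<open>T\<close> itself, not merely in the generated submonoid.\<close>
  then have "\<exists>t\<in>T. t \<otimes> \<one> = \<zero>" if "\<zero> \<in> submonoid_generated R (S \<union> T)"
    using that by auto
  then have "\<zero> \<notin> submonoid_generated R (S \<union> T)"
    using T.S_closed T.S_nonzero by auto
  then show ?thesis
    using generated_Den_l[of "{S, T}"] S T by simp
qed

section \<open>Existence of maximal left denominator sets\<close>

lemma max_Den_l_Den_l: "S \<in> max_Den_l R \<Longrightarrow> S \<in> Den_l R"
  by (simp add: max_Den_l_def)

text \<open>Zorn's lemma applies: the Ore and annihilator conditions concern one element
  \<open>s\<close> at a time, so they hold in a union because they hold in the member containing
  \<open>s\<close>. The chain property is used only for closure under products.\<close>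

lemma Den_l_subset_max_Den_l:
  assumes "S \<in> Den_l R"
  obtains M where "M \<in> max_Den_l R" "S \<subseteq> M"
proof -
  let ?A = "{T \<in> Den_l R. S \<subseteq> T}"
  have "\<exists>M\<in>?A. \<forall>X\<in>?A. M \<subseteq> X \<longrightarrow> X = M"
  proof (rule subset_Zorn_nonempty)
    show "?A \<noteq> {}"
      using assms by blast
    fix C assume C: "C \<noteq> {}" "subset.chain ?A C"
    then have CA: "C \<subseteq> ?A" and chain: "\<And>X Y. \<lbrakk>X \<in> C; Y \<in> C\<rbrakk> \<Longrightarrow> X \<subseteq> Y \<or> Y \<subseteq> X"
      by (simp_all add: subset_chain_def)
    have den: "T \<in> Den_l R" if "T \<in> C" for T
      using subsetD[OF CA that] by simp
    have "\<Union>C \<in> Den_l R"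
      unfolding Den_l_iff
    proof (intro conjI ballI impI)
      show "submonoid (\<Union>C) R"
      proof
        show "\<Union>C \<subseteq> carrier R"
          using den Den_l_carrier by (simp add: Sup_least)
        obtain T where T: "T \<in> C"
          using C(1) by blast
        then show "\<one> \<in> \<Union>C"
          using submonoid.one_closed[OF Den_l_submonoid[OF den[OF T]]] by blast
        fix x y assume "x \<in> \<Union>C" "y \<in> \<Union>C"
        then obtain T where T: "T \<in> C" "x \<in> T" "y \<in> T"
          using chain by (meson UnionE subsetD)
        then show "x \<otimes> y \<in> \<Union>C"
          using submonoid.m_closed[OF Den_l_submonoid[OF den[OF T(1)]]] by blast
      qed
      show "\<zero> \<notin> \<Union>C"
        using den by (auto simp: Den_l_iff)
    next
      fix r s assume r: "r \<in> carrier R" and "s \<in> \<Union>C"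
      then obtain T where T: "T \<in> C" "s \<in> T" by blast
      then interpret T: left_denominator R T
        using den left_denominatorI by simp
      show "\<exists>s'\<in>\<Union>C. \<exists>r'\<in>carrier R. s' \<otimes> r = r' \<otimes> s"
        using T.Ore[OF r T(2)] T(1) by (metis UnionI)
    next
      fix r s assume r: "r \<in> carrier R" "r \<otimes> s = \<zero>" and "s \<in> \<Union>C"
      then obtain T where T: "T \<in> C" "s \<in> T" by blast
      then interpret T: left_denominator R T
        using den left_denominatorI by simp
      show "\<exists>s'\<in>\<Union>C. s' \<otimes> r = \<zero>"
        using T.right_zero[OF r(1) T(2) r(2)] T(1) by (metis UnionI)
    qed
    moreover have "S \<subseteq> \<Union>C"
      using C(1) CA by (metis (mono_tags, lifting) Sup_upper2 ex_in_conv mem_Collect_eq subsetD)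
    ultimately show "\<Union>C \<in> ?A"
      by simp
  qed
  then obtain M where "M \<in> Den_l R" "S \<subseteq> M" "\<And>X. \<lbrakk>X \<in> Den_l R; M \<subseteq> X\<rbrakk> \<Longrightarrow> X = M"
    by (smt (verit) mem_Collect_eq order_trans)
  then show thesis
    using that[of M] by (simp add: max_Den_l_def)
qed

text \<open>The submonoid generated by \<open>S\<close> and \<open>M\<close> is a left denominator
  set above \<open>M\<close>, so maximality forces it to be \<open>M\<close>.\<close>

lemma regular_subset_max_Den_l:
  assumes "S \<in> Den_l R" "ass R S = {\<zero>}" "M \<in> max_Den_l R"
  shows "S \<subseteq> M"
proof -
  have "submonoid_generated R (S \<union> M) \<in> Den_l R"
    using assms generated_Un_Den_l max_Den_l_Den_l by blast
  then show ?thesis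
    using submonoid_generated_incl[of "S \<union> M"] assms(3) unfolding max_Den_l_def by blast
qed

lemma regular_subset_T_l: "\<lbrakk>S \<in> Den_l R; ass R S = {\<zero>}\<rbrakk> \<Longrightarrow> S \<subseteq> T_l R"
  unfolding T_l_def L_sl_def using regular_subset_max_Den_l by blast

lemma T_l_greatest: "\<lbrakk>S \<in> Den_l R; S \<subseteq> L_sl R\<rbrakk> \<Longrightarrow> S \<subseteq> T_l R"
  unfolding T_l_def by blast

lemma T_l_subset: "T_l R \<subseteq> L_sl R"
  unfolding T_l_def by blast

end

section \<open>Units and largest left denominator sets of a nonzero ring\<close>

locale nonzero_ring = ring +
  assumes one_not_zero: "\<one> \<noteq> \<zero>"
begin

lemma Units_Den_l: "Units R \<in> Den_l R"
  unfolding Den_l_iff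
proof (intro conjI ballI impI)
  show "submonoid (Units R) R"
    by unfold_locales auto
  show "\<zero> \<notin> Units R"
    using one_not_zero Units_l_inv[of \<zero>] Units_inv_closed[of \<zero>] by auto
next
  fix r s assume *: "r \<in> carrier R" "s \<in> Units R"
  then have "\<one> \<otimes> r = (r \<otimes> inv s) \<otimes> s"
    by (simp add: m_assoc Units_closed)
  then show "\<exists>s'\<in>Units R. \<exists>r'\<in>carrier R. s' \<otimes> r = r' \<otimes> s"
    using * by blast
next
  fix r s assume *: "r \<in> carrier R" "s \<in> Units R" "r \<otimes> s = \<zero>"
  then have "r = (r \<otimes> s) \<otimes> inv s"
    using Units_closed by (subst m_assoc) simp_all
  then have "r = \<zero>"
    using * by simp
  then show "\<exists>s'\<in>Units R. s' \<otimes> r = \<zero>"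
    using * by (intro bexI[of _ \<one>]) simp_all
qed

lemma ass_Units: "ass R (Units R) = {\<zero>}"
  unfolding ass_zero_iff[OF Units_Den_l] using Units_l_cancel[of _ _ \<zero>] Units_closed by auto

lemma Units_subset_max_Den_l: "M \<in> max_Den_l R \<Longrightarrow> Units R \<subseteq> M"
  using regular_subset_max_Den_l Units_Den_l ass_Units by blast

lemma L_sl_submonoid: "submonoid (L_sl R) R" and L_sl_nonzero: "\<zero> \<notin> L_sl R"
proof -
  \<comment> \<open>The intersection of an empty family would be the whole type. A maximal set above
    \<open>Units R\<close> shows that the family is nonempty.\<close>
  obtain M where M: "M \<in> max_Den_l R"
    using Den_l_subset_max_Den_l Units_Den_l by blast
  note S = Den_l_submonoid[OF max_Den_l_Den_l]
  show "submonoid (L_sl R) R"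
  proof
    show "L_sl R \<subseteq> carrier R"
      using S M submonoid.subset unfolding L_sl_def by blast
  qed (use S in \<open>auto simp: L_sl_def submonoid.m_closed submonoid.one_closed\<close>)
  show "\<zero> \<notin> L_sl R"
    using M max_Den_l_Den_l[OF M] unfolding L_sl_def Den_l_iff by blast
qed

text \<open>The submonoid generated by all candidates stays inside \<open>L_sl R\<close>, a
  submonoid without zero. It is therefore a candidate itself, and the union of the candidates is
  equal to it.\<close>

lemma T_l_Den_l: "T_l R \<in> Den_l R"
proof -
  let ?F = "{S \<in> Den_l R. S \<subseteq> L_sl R}"
  have le: "submonoid_generated R (\<Union>?F) \<subseteq> L_sl R"
    using L_sl_submonoid by (intro submonoid_generated_least) auto
  then have "submonoid_generated R (\<Union>?F) \<in> Den_l R"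
    using L_sl_nonzero by (intro generated_Den_l) auto
  then have "submonoid_generated R (\<Union>?F) = T_l R"
    using le submonoid_generated_incl[of "\<Union>?F"] unfolding T_l_def by blast
  then show ?thesis
    using \<open>submonoid_generated R (\<Union>?F) \<in> Den_l R\<close> by simp
qed

text \<open>In every candidate, left multiplication by each element is injective. This property
  passes to products and excludes zero, so the submonoid generated by all candidates is again a
  candidate and hence the greatest one.\<close>

lemma S_l_Den_l: "S_l R \<in> Den_l R" and ass_S_l: "ass R (S_l R) = {\<zero>}"
proof -
  let ?F = "{S \<in> Den_l R. ass R S = {\<zero>}}"
  let ?M = "submonoid_generated R (\<Union>?F)"
  define reg where "reg s \<longleftrightarrow> (\<forall>r\<in>carrier R. s \<otimes> r = \<zero> \<longrightarrow> r = \<zero>)" for s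
  have reg: "?M \<subseteq> {s \<in> carrier R. reg s}" (is "_ \<subseteq> ?H")
  proof (rule submonoid_generated_least)
    show "submonoid ?H R"
    proof
      fix s t assume "s \<in> ?H" "t \<in> ?H"
      then have st: "s \<in> carrier R" "t \<in> carrier R" "reg s" "reg t"
        by simp_all
      have "reg (s \<otimes> t)"
        unfolding reg_def
      proof (intro ballI impI)
        fix r assume "r \<in> carrier R" "(s \<otimes> t) \<otimes> r = \<zero>"
        then show "r = \<zero>"
          using st m_assoc[of s t r] unfolding reg_def by (metis m_closed)
      qed
      then show "s \<otimes> t \<in> ?H"
        using st by simp
    next
      have "reg \<one>"
        unfolding reg_def by (metis l_one)
      then show "\<one> \<in> ?H"
        by simp
    qed auto
    show "\<Union>?F \<subseteq> ?H"
    proof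
      fix s assume "s \<in> \<Union>?F"
      then obtain S where S: "S \<in> Den_l R" "ass R S = {\<zero>}" "s \<in> S"
        by auto
      then have "reg s"
        unfolding reg_def using ass_zero_iff[of S] by metis
      then show "s \<in> ?H"
        using S(3) Den_l_carrier[OF S(1)] by auto
    qed
  qed
  have "\<not> reg \<zero>"
    unfolding reg_def using one_not_zero by (metis l_null one_closed)
  then have M: "?M \<in> Den_l R"
    using reg by (intro generated_Den_l) auto
  then have ass: "ass R ?M = {\<zero>}"
    using reg unfolding ass_zero_iff[OF M] reg_def[symmetric] by blast
  have "S \<subseteq> ?M" if "S \<in> Den_l R \<and> ass R S = {\<zero>}" for S
    using that by (intro order.trans[OF _ submonoid_generated_incl]) auto
  then have "S_l R = ?M"
    unfolding S_l_def using M ass by (intro Greatest_equality conjI) simp_all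
  then show "S_l R \<in> Den_l R" "ass R (S_l R) = {\<zero>}"
    using M ass by simp_all
qed

end

section \<open>Denominator sets of a ring of left fractions\<close>

locale regular_left_fraction_ring = left_fraction_ring +
  assumes regular: "ass R S = {\<zero>}"
begin

sublocale nonzero_ring R
proof
  show "\<one> \<noteq> \<zero>"
    using S_one S_nonzero by auto
qed

sublocale Q: nonzero_ring Q
  by unfold_locales (rule one_nonzero)

lemma f_eq_zero_iff: "r \<in> carrier R \<Longrightarrow> f r = \<zero>\<^bsub>Q\<^esub> \<longleftrightarrow> r = \<zero>"
  using kernel regular by simp

lemma f_inj:
  assumes "r \<in> carrier R" "q \<in> carrier R" "f r = f q"
  shows "r = q"
  using f_eq_zero_iff[of "r \<ominus> q"] assms
  by (simp add: f_minus f_closed minus_eq_zero_iff Q.minus_eq_zero_iff)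

text \<open>This is the intersection of \<open>R\<close> and \<open>U\<close> once \<open>R\<close>
  is identified with its image under \<open>f\<close>.\<close>

definition restrict where "restrict U = carrier R \<inter> f -` U"

lemma restrict_iff: "r \<in> restrict U \<longleftrightarrow> r \<in> carrier R \<and> f r \<in> U"
  by (simp add: restrict_def)

text \<open>An element of \<open>Q\<close> is a fraction \<open>frac s r\<close>, and a condition on
  it is solved for the numerator \<open>r\<close> in \<open>R\<close> by some \<open>t'\<close> in
  \<open>T\<close>. The product \<open>t' \<otimes> s\<close> then serves for the fraction, and it
  lies in \<open>T\<close> because \<open>S \<subseteq> T\<close>.\<close>

lemma image_Den_l:
  assumes T: "T \<in> Den_l R" and ST: "S \<subseteq> T"
  shows "f ` T \<in> Den_l Q"
proof -
  interpret T: left_denominator R T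
    by (rule left_denominatorI) fact
  have clear: "f (t \<otimes> s) \<otimes>\<^bsub>Q\<^esub> frac s r = f (t \<otimes> r)"
    if "s \<in> S" "r \<in> carrier R" "t \<in> T" for s r t
    using that T.S_closed S_closed
    by (simp add: f_mult f_closed frac_closed Q.m_assoc frac_split)
  show ?thesis
    unfolding Den_l_iff
  proof (intro conjI ballI impI)
    show "submonoid (f ` T) Q"
    proof
      show "\<one>\<^bsub>Q\<^esub> \<in> f ` T"
        using T.S_one f_one by (metis imageI)
      fix x y assume "x \<in> f ` T" "y \<in> f ` T"
      then obtain a b where "a \<in> T" "b \<in> T" "x = f a" "y = f b"
        by auto
      then show "x \<otimes>\<^bsub>Q\<^esub> y \<in> f ` T"
        using T.S_mult[of a b] by (simp add: f_mult[symmetric] T.S_closed)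
    qed (use T.S_closed f_closed in auto)
    show "\<zero>\<^bsub>Q\<^esub> \<notin> f ` T"
      using T.S_nonzero T.S_closed f_eq_zero_iff by (metis imageE)
  next
    fix q u assume "q \<in> carrier Q" "u \<in> f ` T"
    then obtain s r t where *: "s \<in> S" "r \<in> carrier R" "q = frac s r" "t \<in> T" "u = f t"
      by (metis frac_cases imageE)
    then obtain t' r' where t': "t' \<in> T" "r' \<in> carrier R" "t' \<otimes> r = r' \<otimes> t"
      using T.Ore by metis
    have "f (t' \<otimes> s) \<otimes>\<^bsub>Q\<^esub> q = f r' \<otimes>\<^bsub>Q\<^esub> u"
      using * t' T.S_closed by (simp add: clear f_mult)
    moreover have "t' \<otimes> s \<in> T"
      using t' * ST T.S_mult by blast
    ultimately show "\<exists>s'\<in>f ` T. \<exists>r'\<in>carrier Q. s' \<otimes>\<^bsub>Q\<^esub> q = r' \<otimes>\<^bsub>Q\<^esub> u"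
      using t'(2) f_closed by blast
  next
    fix q u assume "q \<in> carrier Q" "u \<in> f ` T" and zero: "q \<otimes>\<^bsub>Q\<^esub> u = \<zero>\<^bsub>Q\<^esub>"
    then obtain s r t where *: "s \<in> S" "r \<in> carrier R" "q = frac s r" "t \<in> T" "u = f t"
      by (metis frac_cases imageE)
    have "f (r \<otimes> t) = f s \<otimes>\<^bsub>Q\<^esub> (q \<otimes>\<^bsub>Q\<^esub> u)"
      using * T.S_closed units_closed f_closed frac_closed
      by (simp add: f_mult Q.m_assoc[symmetric] frac_split)
    then have "r \<otimes> t = \<zero>"
      using zero * T.S_closed units_closed f_eq_zero_iff by simp
    then obtain t' where t': "t' \<in> T" "t' \<otimes> r = \<zero>"
      using T.right_zero * by metis
    then have "f (t' \<otimes> s) \<otimes>\<^bsub>Q\<^esub> q = \<zero>\<^bsub>Q\<^esub>"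
      using * by (simp add: clear f_zero)
    moreover have "t' \<otimes> s \<in> T"
      using t' * ST T.S_mult by blast
    ultimately show "\<exists>s'\<in>f ` T. s' \<otimes>\<^bsub>Q\<^esub> q = \<zero>\<^bsub>Q\<^esub>"
      by blast
  qed
qed

end

section \<open>Left denominator sets containing the units\<close>

locale unit_denominator = regular_left_fraction_ring +
  fixes U
  assumes U: "U \<in> Den_l Q" and units_U: "Units Q \<subseteq> U"
begin

sublocale U: left_denominator Q U
  by (rule Q.left_denominatorI) (rule U)

lemma f_S_in_U: "s \<in> S \<Longrightarrow> f s \<in> U" "s \<in> S \<Longrightarrow> inv\<^bsub>Q\<^esub> f s \<in> U"
  using units units_U by blast+

text \<open>Both \<open>f s\<close> and its inverse lie in \<open>U\<close>, so multiplying by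
  either preserves membership.\<close>

lemma frac_in_U_iff:
  assumes "s \<in> S" "r \<in> carrier R"
  shows "frac s r \<in> U \<longleftrightarrow> r \<in> restrict U"
proof
  assume "frac s r \<in> U"
  then have "f s \<otimes>\<^bsub>Q\<^esub> frac s r \<in> U"
    using assms f_S_in_U U.S_mult by blast
  then show "r \<in> restrict U"
    using assms by (simp add: frac_split restrict_iff)
next
  assume "r \<in> restrict U"
  then show "frac s r \<in> U"
    unfolding frac_def restrict_iff using assms f_S_in_U U.S_mult by blast
qed

lemma U_eq: "U = {frac s t | s t. s \<in> S \<and> t \<in> restrict U}"
proof
  show "U \<subseteq> {frac s t | s t. s \<in> S \<and> t \<in> restrict U}"
  proof
    fix u assume u: "u \<in> U"
    then obtain s r where "s \<in> S" "r \<in> carrier R" "u = frac s r"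
      using frac_cases U.S_closed by metis
    then show "u \<in> {frac s t | s t. s \<in> S \<and> t \<in> restrict U}"
      using u frac_in_U_iff by blast
  qed
  show "{frac s t | s t. s \<in> S \<and> t \<in> restrict U} \<subseteq> U"
    using frac_in_U_iff by (auto simp: restrict_iff)
qed

text \<open>An annihilator \<open>u\<close> in \<open>U\<close> is a fraction; its numerator lies in
  \<open>restrict U\<close> and still annihilates, and injectivity of \<open>f\<close> brings the
  equation down to \<open>R\<close>.\<close>

lemma annihilated_iff:
  assumes r: "r \<in> carrier R"
  shows "f r \<in> ass Q U \<longleftrightarrow> r \<in> ass R (restrict U)"
proof
  assume "f r \<in> ass Q U"
  then obtain u where u: "u \<in> U" "u \<otimes>\<^bsub>Q\<^esub> f r = \<zero>\<^bsub>Q\<^esub>"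
    by (auto simp: ass_def)
  obtain s a where a: "s \<in> S" "a \<in> carrier R" "u = frac s a"
    using u U.S_closed frac_cases by metis
  have "f (a \<otimes> r) = f s \<otimes>\<^bsub>Q\<^esub> (u \<otimes>\<^bsub>Q\<^esub> f r)"
    using a r units_closed f_closed frac_closed
    by (simp add: f_mult Q.m_assoc[symmetric] frac_split)
  then have "a \<otimes> r = \<zero>"
    using u a r units_closed f_eq_zero_iff by simp
  then show "r \<in> ass R (restrict U)"
    using r u a frac_in_U_iff by (auto simp: ass_def)
next
  assume "r \<in> ass R (restrict U)"
  then obtain t where t: "t \<in> carrier R" "f t \<in> U" "t \<otimes> r = \<zero>"
    by (auto simp: ass_def restrict_iff)
  then have "f t \<otimes>\<^bsub>Q\<^esub> f r = \<zero>\<^bsub>Q\<^esub>"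
    using r by (simp add: f_mult[symmetric] f_zero)
  then show "f r \<in> ass Q U"
    using t r f_closed by (auto simp: ass_def)
qed

lemma frac_annihilated_iff:
  assumes sr: "s \<in> S" "r \<in> carrier R"
  shows "frac s r \<in> ass Q U \<longleftrightarrow> f r \<in> ass Q U"
proof
  assume "frac s r \<in> ass Q U"
  then obtain u where u: "u \<in> U" "u \<otimes>\<^bsub>Q\<^esub> frac s r = \<zero>\<^bsub>Q\<^esub>"
    by (auto simp: ass_def)
  then have "(u \<otimes>\<^bsub>Q\<^esub> inv\<^bsub>Q\<^esub> f s) \<otimes>\<^bsub>Q\<^esub> f r = \<zero>\<^bsub>Q\<^esub>"
    using sr units U.S_closed f_closed by (simp add: frac_def Q.m_assoc)
  then show "f r \<in> ass Q U"
    using u sr f_S_in_U U.S_mult f_closed unfolding ass_def by blast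
next
  assume "f r \<in> ass Q U"
  then obtain u where u: "u \<in> U" "u \<otimes>\<^bsub>Q\<^esub> f r = \<zero>\<^bsub>Q\<^esub>"
    by (auto simp: ass_def)
  then have "(u \<otimes>\<^bsub>Q\<^esub> f s) \<otimes>\<^bsub>Q\<^esub> frac s r = \<zero>\<^bsub>Q\<^esub>"
    using sr units_closed U.S_closed frac_closed by (simp add: Q.m_assoc frac_split)
  then show "frac s r \<in> ass Q U"
    using u sr f_S_in_U U.S_mult frac_closed unfolding ass_def by blast
qed

lemma ass_restrict: "ass R (restrict U) = restrict (ass Q U)"
  using annihilated_iff by (auto simp: restrict_iff) (auto simp: ass_def)

lemma ass_eq: "ass Q U = {frac s r | s r. s \<in> S \<and> r \<in> ass R (restrict U)}"
proof
  show "ass Q U \<subseteq> {frac s r | s r. s \<in> S \<and> r \<in> ass R (restrict U)}"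
  proof
    fix q assume q: "q \<in> ass Q U"
    then have "q \<in> carrier Q"
      by (simp add: ass_def)
    then obtain s r where "s \<in> S" "r \<in> carrier R" "q = frac s r"
      by (rule frac_cases)
    then show "q \<in> {frac s r | s r. s \<in> S \<and> r \<in> ass R (restrict U)}"
      using q frac_annihilated_iff annihilated_iff by blast
  qed
  show "{frac s r | s r. s \<in> S \<and> r \<in> ass R (restrict U)} \<subseteq> ass Q U"
    using frac_annihilated_iff by (auto simp: ass_restrict restrict_iff)
qed

text \<open>This is how equations with coefficients \<open>u\<close> and \<open>p\<close> in
  \<open>Q\<close> descend to \<open>R\<close>: one left factor \<open>f s\<close> turns both into
  images of elements of \<open>R\<close>, and the image of the first stays in
  \<open>U\<close>.\<close>

lemma clear_denominators:
  assumes "u \<in> U" "p \<in> carrier Q"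
  obtains s a b where "s \<in> S" "a \<in> restrict U" "b \<in> carrier R"
    "f s \<otimes>\<^bsub>Q\<^esub> u = f a" "f s \<otimes>\<^bsub>Q\<^esub> p = f b"
proof -
  obtain s a b where *: "s \<in> S" "a \<in> carrier R" "b \<in> carrier R" "u = frac s a" "p = frac s b"
    using frac_cases2[of u p] assms U.S_closed by metis
  then show thesis
    using that[of s a b] assms(1) frac_in_U_iff by (simp add: frac_split)
qed

text \<open>Each condition is solved in \<open>Q\<close>, the denominators of the solution are
  cleared, and injectivity of \<open>f\<close> yields the equation in \<open>R\<close>.\<close>

lemma restrict_Den_l: "restrict U \<in> Den_l R"
  unfolding Den_l_iff
proof (intro conjI ballI impI)
  show "submonoid (restrict U) R"
    by unfold_locales (auto simp: restrict_iff f_mult f_one U.S_mult U.S_one)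
  show "\<zero> \<notin> restrict U"
    by (simp add: restrict_iff f_zero U.S_nonzero)
next
  fix r t assume r: "r \<in> carrier R" and "t \<in> restrict U"
  then have t: "t \<in> carrier R" "f t \<in> U"
    by (simp_all add: restrict_iff)
  obtain u p where u: "u \<in> U" "p \<in> carrier Q" "u \<otimes>\<^bsub>Q\<^esub> f r = p \<otimes>\<^bsub>Q\<^esub> f t"
    using U.Ore r t f_closed by metis
  obtain s a b where s: "s \<in> S" "a \<in> restrict U" "b \<in> carrier R"
      "f s \<otimes>\<^bsub>Q\<^esub> u = f a" "f s \<otimes>\<^bsub>Q\<^esub> p = f b"
    using u clear_denominators by metis
  have a: "a \<in> carrier R"
    using s by (simp add: restrict_iff)
  have "f (a \<otimes> r) = f s \<otimes>\<^bsub>Q\<^esub> (u \<otimes>\<^bsub>Q\<^esub> f r)"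
    using s(1) a r u(1) units_closed f_closed U.S_closed
    by (simp add: f_mult s(4)[symmetric] Q.m_assoc)
  also have "\<dots> = f (b \<otimes> t)"
    unfolding u(3) using s(1,3) t u(2) units_closed f_closed
    by (simp add: f_mult s(5)[symmetric] Q.m_assoc)
  finally have "a \<otimes> r = b \<otimes> t"
    using f_inj[of "a \<otimes> r" "b \<otimes> t"] a r s(3) t by simp
  then show "\<exists>s'\<in>restrict U. \<exists>r'\<in>carrier R. s' \<otimes> r = r' \<otimes> t"
    using s by blast
next
  fix r t assume r: "r \<in> carrier R" "r \<otimes> t = \<zero>" and "t \<in> restrict U"
  then have t: "t \<in> carrier R" "f t \<in> U"
    by (simp_all add: restrict_iff)
  have "f r \<otimes>\<^bsub>Q\<^esub> f t = \<zero>\<^bsub>Q\<^esub>"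
    using r t by (simp add: f_mult[symmetric] f_zero)
  then obtain u where "u \<in> U" "u \<otimes>\<^bsub>Q\<^esub> f r = \<zero>\<^bsub>Q\<^esub>"
    using U.right_zero r t f_closed by metis
  then have "f r \<in> ass Q U"
    using r f_closed by (auto simp: ass_def)
  then show "\<exists>s'\<in>restrict U. s' \<otimes> r = \<zero>"
    using annihilated_iff r by (auto simp: ass_def)
qed

text \<open>The composite of \<open>f\<close> with the canonical map of \<open>Q\<close> into its
  localization makes the latter a ring of left fractions of \<open>R\<close> with respect to
  \<open>restrict U\<close>. Numerators and denominators from \<open>Q\<close> are replaced by ones
  from \<open>R\<close> through \<open>clear_denominators\<close>, and uniqueness applies.\<close>

lemma restrict_localization_iso:
  "left_localization R (restrict U) \<simeq> left_localization Q U"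
proof -
  let ?L = "left_localization Q U" and ?g = "lfrac Q U \<one>\<^bsub>Q\<^esub>"
  interpret G: left_fraction_ring Q U ?L ?g
    by (rule U.left_fraction_ring_localization)
  interpret G': left_fraction_ring R "restrict U" ?L "?g \<circ> f"
  proof (intro left_fraction_ring.intro left_fraction_ring_axioms.intro left_denominatorI
      restrict_Den_l G.Q.ring_axioms)
    show "?g \<circ> f \<in> ring_hom R ?L"
      using hom G.hom by (rule ring_hom_trans)
    show "(?g \<circ> f) s \<in> Units ?L" if "s \<in> restrict U" for s
      using that G.units by (simp add: restrict_iff)
    show "(?g \<circ> f) r = \<zero>\<^bsub>?L\<^esub> \<longleftrightarrow> r \<in> ass R (restrict U)" if "r \<in> carrier R" for r
      using that G.kernel annihilated_iff f_closed by simp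
    fix q assume q: "q \<in> carrier ?L"
    then obtain u p where u: "u \<in> U" "p \<in> carrier Q" "?g u \<otimes>\<^bsub>?L\<^esub> q = ?g p"
      using G.fraction by blast
    obtain s a b where s: "s \<in> S" "a \<in> restrict U" "b \<in> carrier R"
        "f s \<otimes>\<^bsub>Q\<^esub> u = f a" "f s \<otimes>\<^bsub>Q\<^esub> p = f b"
      using u clear_denominators by metis
    have "?g (f a) \<otimes>\<^bsub>?L\<^esub> q = ?g (f s) \<otimes>\<^bsub>?L\<^esub> (?g u \<otimes>\<^bsub>?L\<^esub> q)"
      using s(1) u(1) q units_closed U.S_closed
      by (simp add: s(4)[symmetric] G.f_mult G.f_closed G.Q.m_assoc)
    also have "\<dots> = ?g (f b)"
      unfolding u(3) using s(1) u(2) units_closed by (simp add: s(5)[symmetric] G.f_mult)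
    finally show "\<exists>s\<in>restrict U. \<exists>r\<in>carrier R. (?g \<circ> f) s \<otimes>\<^bsub>?L\<^esub> q = (?g \<circ> f) r"
      using s by auto
  qed
  show ?thesis
    by (rule G'.localization_iso)
qed

end

section \<open>Correspondence of maximal left denominator sets\<close>

context regular_left_fraction_ring
begin

lemma unit_denominatorI: "\<lbrakk>U \<in> Den_l Q; Units Q \<subseteq> U\<rbrakk> \<Longrightarrow> unit_denominator R S Q f U"
  by unfold_locales

lemma max_unit_denominator: "U \<in> max_Den_l Q \<Longrightarrow> unit_denominator R S Q f U"
  using unit_denominatorI Q.max_Den_l_Den_l Q.Units_subset_max_Den_l by blast

lemma subset_restrict_iff: "T \<subseteq> carrier R \<Longrightarrow> T \<subseteq> restrict U \<longleftrightarrow> f ` T \<subseteq> U"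
  unfolding restrict_def by blast

lemma Den_l_subset_restrict_max:
  assumes T: "T \<in> Den_l R" "S \<subseteq> T"
  obtains U where "U \<in> max_Den_l Q" "T \<subseteq> restrict U"
proof -
  obtain U where "U \<in> max_Den_l Q" "f ` T \<subseteq> U"
    using Q.Den_l_subset_max_Den_l image_Den_l T by blast
  then show thesis
    using that subset_restrict_iff Den_l_carrier T by blast
qed

lemma S_subset_max: "T \<in> max_Den_l R \<Longrightarrow> S \<subseteq> T"
  using regular_subset_max_Den_l den regular by blast

text \<open>The image of \<open>T\<close> in \<open>Q\<close> extends to a maximal set
  \<open>U\<close>. Its restriction is a left denominator set containing \<open>T\<close>, hence
  equal to \<open>T\<close>.\<close>

lemma max_Den_l_eq_restrict:
  assumes T: "T \<in> max_Den_l R"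
  obtains U where "U \<in> max_Den_l Q" "T = restrict U"
proof -
  obtain U where U: "U \<in> max_Den_l Q" "T \<subseteq> restrict U"
    using Den_l_subset_restrict_max[OF max_Den_l_Den_l[OF T] S_subset_max[OF T]] by metis
  interpret U: unit_denominator R S Q f U
    using U max_unit_denominator by simp
  have "restrict U = T"
    using U(2) T U.restrict_Den_l by (simp add: max_Den_l_def)
  then show thesis
    using that[OF U(1)] by simp
qed

text \<open>A maximal set above \<open>restrict U\<close> has the form \<open>restrict V\<close>
  with \<open>V\<close> maximal. By \<open>U_eq\<close> both \<open>U\<close> and \<open>V\<close>
  consist of the fractions with numerators in their restrictions, so \<open>U \<subseteq> V\<close>,
  and maximality of \<open>U\<close> gives equality.\<close>

lemma restrict_max_Den_l:
  assumes U: "U \<in> max_Den_l Q"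
  shows "restrict U \<in> max_Den_l R"
proof -
  interpret U: unit_denominator R S Q f U
    using U max_unit_denominator by simp
  obtain T where T: "T \<in> max_Den_l R" "restrict U \<subseteq> T"
    using Den_l_subset_max_Den_l U.restrict_Den_l by blast
  obtain V where V: "V \<in> max_Den_l Q" "T = restrict V"
    using max_Den_l_eq_restrict[OF T(1)] by metis
  interpret V: unit_denominator R S Q f V
    using V max_unit_denominator by simp
  have "U \<subseteq> V"
    using T(2) unfolding V(2) by (subst U.U_eq, subst V.U_eq) blast
  then have "V = U"
    using U V(1) by (simp add: max_Den_l_def)
  then show ?thesis
    using T V by simp
qed

lemma max_Den_l_eq: "max_Den_l R = restrict ` max_Den_l Q"
proof (intro equalityI subsetI)
  fix T assume "T \<in> max_Den_l R"
  then show "T \<in> restrict ` max_Den_l Q"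
    by (rule max_Den_l_eq_restrict) blast
qed (use restrict_max_Den_l in auto)

lemma L_sl_eq: "L_sl R = restrict (L_sl Q)"
proof -
  \<comment> \<open>Restriction includes the intersection with \<open>carrier R\<close>, so it
    commutes with the intersection of a family only if the family is nonempty.\<close>
  have "max_Den_l Q \<noteq> {}"
    using Q.Den_l_subset_max_Den_l Q.Units_Den_l by blast
  then show ?thesis
    unfolding L_sl_def max_Den_l_eq restrict_def by auto
qed

sublocale T: unit_denominator R S Q f "T_l Q"
  by (intro unit_denominatorI Q.T_l_Den_l Q.regular_subset_T_l Q.Units_Den_l Q.ass_Units)

text \<open>Each side is a left denominator set after transport to the other ring and lies in the
  intersection of the maximal sets there, by \<open>L_sl_eq\<close>. For the image of
  \<open>T_l R\<close> this requires \<open>S \<subseteq> T_l R\<close>, which holds because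
  \<open>ass R S\<close> is zero.\<close>

lemma T_l_eq: "T_l R = restrict (T_l Q)"
proof
  have "S \<subseteq> T_l R"
    by (rule regular_subset_T_l[OF den regular])
  then have "f ` T_l R \<in> Den_l Q"
    by (rule image_Den_l[OF T_l_Den_l])
  moreover have "f ` T_l R \<subseteq> L_sl Q"
    using T_l_subset unfolding L_sl_eq by (auto simp: restrict_iff)
  ultimately have "f ` T_l R \<subseteq> T_l Q"
    by (rule Q.T_l_greatest)
  then show "T_l R \<subseteq> restrict (T_l Q)"
    using subset_restrict_iff[OF Den_l_carrier[OF T_l_Den_l]] by simp
  have "restrict (T_l Q) \<subseteq> L_sl R"
    unfolding L_sl_eq using Q.T_l_subset by (auto simp: restrict_iff)
  then show "restrict (T_l Q) \<subseteq> T_l R"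
    by (rule T_l_greatest[OF T.restrict_Den_l])
qed

lemma T_l_fractions: "T_l Q = {frac s t | s t. s \<in> S \<and> t \<in> T_l R}"
  unfolding T_l_eq by (rule T.U_eq)

text \<open>By \<open>T_l_fractions\<close> every element of \<open>T_l Q\<close> is the inverse of
  a unit times an element of the image of \<open>T_l R\<close>.\<close>

lemma T_l_generated: "T_l Q = submonoid_generated Q (Units Q \<union> f ` T_l R)"
proof
  have "f ` T_l R \<subseteq> T_l Q"
    unfolding T_l_eq restrict_def by blast
  then have sub: "Units Q \<union> f ` T_l R \<subseteq> T_l Q"
    using T.units_U by simp
  then show "submonoid_generated Q (Units Q \<union> f ` T_l R) \<subseteq> T_l Q"
    by (intro Q.submonoid_generated_least Q.Den_l_submonoid Q.T_l_Den_l)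
  interpret M: submonoid "submonoid_generated Q (Units Q \<union> f ` T_l R)" Q
    by (rule Q.submonoid_generated_submonoid)
      (rule order.trans[OF sub Q.Den_l_carrier[OF Q.T_l_Den_l]])
  note incl = subsetD[OF Q.submonoid_generated_incl]
  show "T_l Q \<subseteq> submonoid_generated Q (Units Q \<union> f ` T_l R)"
  proof
    fix u assume "u \<in> T_l Q"
    then obtain s t where "s \<in> S" "t \<in> T_l R" "u = inv\<^bsub>Q\<^esub> f s \<otimes>\<^bsub>Q\<^esub> f t"
      by (auto simp: T_l_fractions frac_def)
    moreover from this have "inv\<^bsub>Q\<^esub> f s \<in> submonoid_generated Q (Units Q \<union> f ` T_l R)"
        "f t \<in> submonoid_generated Q (Units Q \<union> f ` T_l R)"
      using units by (auto intro!: incl)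
    ultimately show "u \<in> submonoid_generated Q (Units Q \<union> f ` T_l R)"
      by simp
  qed
qed

end

theorem theorem1p6:
  fixes R :: "('a, 'm) ring_scheme"
  assumes "ring R" and "\<one>\<^bsub>R\<^esub> \<noteq> \<zero>\<^bsub>R\<^esub>"
  shows "(T_l (Q_l R) = submonoid_generated (Q_l R) (Units (Q_l R) \<union> Q_l_inj R ` T_l R)) \<and>
         (submonoid_generated (Q_l R) (Units (Q_l R) \<union> Q_l_inj R ` T_l R) =
           {lfrac R (S_l R) s t | s t. s \<in> S_l R \<and> t \<in> T_l R}) \<and>
         (T_l R = carrier R \<inter> Q_l_inj R -` T_l (Q_l R)) \<and>
         (ass_sl (Q_l R) = {lfrac R (S_l R) s r | s r. s \<in> S_l R \<and> r \<in> ass_sl R}) \<and>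
         (ass_sl R = carrier R \<inter> Q_l_inj R -` ass_sl (Q_l R)) \<and>
         (Q_sl R \<simeq> Q_sl (Q_l R))"
proof -
  interpret R0: nonzero_ring R
    using assms by (simp add: nonzero_ring.intro nonzero_ring_axioms.intro)
  interpret S: left_denominator R "S_l R"
    by (intro R0.left_denominatorI R0.S_l_Den_l)
  have inj: "Q_l_inj R = lfrac R (S_l R) \<one>\<^bsub>R\<^esub>"
    by (simp add: Q_l_inj_def fun_eq_iff)
  interpret Q: regular_left_fraction_ring R "S_l R" "Q_l R" "Q_l_inj R"
    unfolding Q_l_def inj
    by (intro regular_left_fraction_ring.intro regular_left_fraction_ring_axioms.intro
        S.left_fraction_ring_localization R0.ass_S_l)
  \<comment> \<open>The concrete class and the abstract fraction solve the same equation with a unit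
    coefficient, so \<open>eq_fracI\<close> identifies them.\<close>
  have frac: "Q.frac s r = lfrac R (S_l R) s r" if "s \<in> S_l R" "r \<in> carrier R" for s r
    using Q.eq_fracI[of s r "lfrac R (S_l R) s r"] that S.lfrac_split S.lfrac_closed
    by (simp add: Q_l_def inj)
  have fracs: "{Q.frac s r | s r. s \<in> S_l R \<and> r \<in> A} = {lfrac R (S_l R) s r | s r. s \<in> S_l R \<and> r \<in> A}"
    if "A \<subseteq> carrier R" for A
    using that frac by (intro Collect_cong) (metis subsetD)
  have T: "T_l R \<subseteq> carrier R"
    using R0.T_l_Den_l R0.Den_l_carrier by simp
  have ass: "ass_sl R \<subseteq> carrier R"
    by (auto simp: ass_sl_def ass_def)
  have "ass_sl (Q_l R) = {Q.frac s r | s r. s \<in> S_l R \<and> r \<in> ass_sl R}"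
    unfolding ass_sl_def Q.T_l_eq by (rule Q.T.ass_eq)
  moreover have "ass_sl R = carrier R \<inter> Q_l_inj R -` ass_sl (Q_l R)"
    unfolding ass_sl_def Q.T_l_eq Q.T.ass_restrict by (rule Q.restrict_def)
  moreover have "Q_sl R \<simeq> Q_sl (Q_l R)"
    unfolding Q_sl_def Q.T_l_eq by (rule Q.T.restrict_localization_iso)
  moreover have "T_l R = carrier R \<inter> Q_l_inj R -` T_l (Q_l R)"
    using Q.T_l_eq unfolding Q.restrict_def .
  ultimately show ?thesis
    using Q.T_l_generated Q.T_l_fractions fracs[OF T] fracs[OF ass] by simp
qed

end
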